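(* There is a universal constant $C\in(0,\infty)$ with the following property. Let $p\in[2,\infty)$, $n\in\mathbb N$, $k\in[n]$, $t=k/n$, and let $S$ be uniformly distributed among the $k$-element subsets of $[n]$. Then for $\mathbb K\in\{\mathbb R,\mathbb C\}$ every $h:\Omega_n\to\mathbb K$ with $\mathbb E h=0$ satisfies $$\left(\mathbb E_S\|P_Sh\|_p^p\right)^{1/p}\le t\|h\|_p+C\frac p{\log p}\left(t\sum_{j=1}^n\|D_jh\|_p^p\right)^{1/p}+\frac{C\pi}{2}\,\frac p{\log p}\,\sqrt t\,\|h\|_p .$$ Moreover, if $(M,\nu)$ is a measure space and $h:\Omega_n\to L_p(M,\nu)$ (over either the real or the complex scalar field) satisfies $\mathbb E_\varepsilon h(\varepsilon)=0$ in $L_p(M,\nu)$, then the same estimate holds, with the same constant $C$, when each norm $\|\cdot\|_p$ is the Bochner norm of $L_p(\Omega_n;L_p(M,\nu))$.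
   Context: $[n]=\{1,\dots,n\}$, $\Omega_n=\{-1,1\}^n$ with the uniform probability measure; $\mathbb E$ is the average over $\Omega_n$ and, for scalar $h$, $\|h\|_p=(\mathbb E|h|^p)^{1/p}$; for $h:\Omega_n\to L_p(M,\nu)$ the Bochner norm is $\|h\|_p=(\mathbb E_\varepsilon\|h(\varepsilon)\|_{L_p(M,\nu)}^p)^{1/p}$. For $S\subseteq[n]$, $P_Sh(\varepsilon)$ is the average of $h(\eta)$ over all $\eta\in\Omega_n$ with $\eta_j=\varepsilon_j$ for every $j\in S$ (conditional expectation over the coordinates outside $S$). If $\varepsilon^{(j)}$ is obtained from $\varepsilon$ by changing the sign of the $j$th coordinate, then $D_jh(\varepsilon)=\frac12\bigl(h(\varepsilon)-h(\varepsilon^{(j)})\bigr)$. The same formulas define $P_S$ and $D_j$ on vector-valued functions. Logarithms are natural. "Universal constant" means an absolute constant independent of all parameters. *)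

theory Defs
  imports "HOL-Analysis.Analysis"
begin

definition average :: "'i set \<Rightarrow> ('i \<Rightarrow> 'b::real_vector) \<Rightarrow> 'b" where
  "average A f = (1 / real (card A)) *\<^sub>R (\<Sum>i\<in>A. f i)"

definition cube :: "nat \<Rightarrow> (nat \<Rightarrow> int) set" where
  "cube n = {1..n} \<rightarrow>\<^sub>E {-1, 1}"

definition k_subsets :: "nat \<Rightarrow> nat \<Rightarrow> nat set set" where
  "k_subsets n k = {S. S \<subseteq> {1..n} \<and> card S = k}"

definition cond_proj :: "nat \<Rightarrow> nat set \<Rightarrow> ((nat \<Rightarrow> int) \<Rightarrow> 'b::real_vector) \<Rightarrow> (nat \<Rightarrow> int) \<Rightarrow> 'b" where
  "cond_proj n S h \<epsilon> = average {\<eta> \<in> cube n. \<forall>j\<in>S. \<eta> j = \<epsilon> j} h"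

definition flip_coord :: "nat \<Rightarrow> (nat \<Rightarrow> int) \<Rightarrow> nat \<Rightarrow> int" where
  "flip_coord j \<epsilon> = \<epsilon>(j := - \<epsilon> j)"

definition discrete_deriv :: "nat \<Rightarrow> ((nat \<Rightarrow> int) \<Rightarrow> 'b::real_vector) \<Rightarrow> (nat \<Rightarrow> int) \<Rightarrow> 'b" where
  "discrete_deriv j h \<epsilon> = (1/2) *\<^sub>R (h \<epsilon> - h (flip_coord j \<epsilon>))"

definition cube_norm :: "nat \<Rightarrow> real \<Rightarrow> ((nat \<Rightarrow> int) \<Rightarrow> 'b::real_normed_vector) \<Rightarrow> real" where
  "cube_norm n p h = (average (cube n) (\<lambda>\<epsilon>. norm (h \<epsilon>) powr p)) powr (1/p)"

text \<open>Elements of \<open>L\<^sub>p(M)\<close> are given by representatives, i.e. measurable functions whose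
  \<open>p\<close>-th power is integrable; equality in \<open>L\<^sub>p(M)\<close> is equality almost everywhere.
  Everything below depends only on the classes of the functions involved.\<close>

definition in_Lp :: "real \<Rightarrow> 'a measure \<Rightarrow> ('a \<Rightarrow> 'b::{banach, second_countable_topology}) \<Rightarrow> bool" where
  "in_Lp p M f \<longleftrightarrow> f \<in> borel_measurable M \<and> integrable M (\<lambda>x. norm (f x) powr p)"

definition Lp_norm :: "real \<Rightarrow> 'a measure \<Rightarrow> ('a \<Rightarrow> 'b::{banach, second_countable_topology}) \<Rightarrow> real" where
  "Lp_norm p M f = (\<integral>x. norm (f x) powr p \<partial>M) powr (1/p)"

definition bochner_norm ::
  "nat \<Rightarrow> real \<Rightarrow> 'a measure \<Rightarrow> ((nat \<Rightarrow> int) \<Rightarrow> 'a \<Rightarrow> 'b::{banach, second_countable_topology}) \<Rightarrow> real" where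
  "bochner_norm n p M h = (average (cube n) (\<lambda>\<epsilon>. Lp_norm p M (h \<epsilon>) powr p)) powr (1/p)"

text \<open>The linear operations of \<open>L\<^sub>p(M)\<close> act pointwise on representatives, hence so do
  \<open>cond_proj\<close> and \<open>discrete_deriv\<close> on \<open>L\<^sub>p(M)\<close>-valued functions.\<close>

definition cond_proj_Lp ::
  "nat \<Rightarrow> nat set \<Rightarrow> ((nat \<Rightarrow> int) \<Rightarrow> 'a \<Rightarrow> 'b::real_vector) \<Rightarrow> (nat \<Rightarrow> int) \<Rightarrow> 'a \<Rightarrow> 'b" where
  "cond_proj_Lp n S h \<epsilon> x = cond_proj n S (\<lambda>\<eta>. h \<eta> x) \<epsilon>"

definition discrete_deriv_Lp ::
  "nat \<Rightarrow> ((nat \<Rightarrow> int) \<Rightarrow> 'a \<Rightarrow> 'b::real_vector) \<Rightarrow> (nat \<Rightarrow> int) \<Rightarrow> 'a \<Rightarrow> 'b" where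
  "discrete_deriv_Lp j h \<epsilon> x = discrete_deriv j (\<lambda>\<eta>. h \<eta> x) \<epsilon>"

definition scalar_estimate ::
  "real \<Rightarrow> real \<Rightarrow> nat \<Rightarrow> nat \<Rightarrow> ((nat \<Rightarrow> int) \<Rightarrow> 'b::real_normed_vector) \<Rightarrow> bool" where
  "scalar_estimate C p n k h \<longleftrightarrow>
    (let t = real k / real n in
      (average (k_subsets n k) (\<lambda>S. cube_norm n p (cond_proj n S h) powr p)) powr (1/p)
      \<le> t * cube_norm n p h
        + C * (p / ln p) * (t * (\<Sum>j=1..n. cube_norm n p (discrete_deriv j h) powr p)) powr (1/p)
        + C * pi / 2 * (p / ln p) * sqrt t * cube_norm n p h)"

definition Lp_estimate ::
  "real \<Rightarrow> real \<Rightarrow> nat \<Rightarrow> nat \<Rightarrow> 'a measure \<Rightarrow>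
    ((nat \<Rightarrow> int) \<Rightarrow> 'a \<Rightarrow> 'b::{banach, second_countable_topology}) \<Rightarrow> bool" where
  "Lp_estimate C p n k M h \<longleftrightarrow>
    (let t = real k / real n in
      (average (k_subsets n k) (\<lambda>S. bochner_norm n p M (cond_proj_Lp n S h) powr p)) powr (1/p)
      \<le> t * bochner_norm n p M h
        + C * (p / ln p) * (t * (\<Sum>j=1..n. bochner_norm n p M (discrete_deriv_Lp j h) powr p)) powr (1/p)
        + C * pi / 2 * (p / ln p) * sqrt t * bochner_norm n p M h)"

definition scalar_bound :: "real \<Rightarrow> 'b::real_normed_vector itself \<Rightarrow> bool" where
  "scalar_bound C _ \<longleftrightarrow>
    (\<forall>p n k. \<forall>h :: (nat \<Rightarrow> int) \<Rightarrow> 'b. 2 \<le> p \<and> k \<in> {1..n} \<and> average (cube n) h = 0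
      \<longrightarrow> scalar_estimate C p n k h)"

definition Lp_bound ::
  "real \<Rightarrow> 'a measure \<Rightarrow> 'b::{banach, second_countable_topology} itself \<Rightarrow> bool" where
  "Lp_bound C M _ \<longleftrightarrow>
    (\<forall>p n k. \<forall>h :: (nat \<Rightarrow> int) \<Rightarrow> 'a \<Rightarrow> 'b.
      2 \<le> p \<and> k \<in> {1..n} \<and> (\<forall>\<epsilon>\<in>cube n. in_Lp p M (h \<epsilon>)) \<and>
      (AE x in M. average (cube n) (\<lambda>\<epsilon>. h \<epsilon> x) = 0)
      \<longrightarrow> Lp_estimate C p n k M h)"

text \<open>A bound variable cannot range over measure spaces of all types, so in
  \<open>\<exists>C. \<dots> \<and> (\<forall>M :: 'a measure. Lp_bound C M \<dots>)\<close> the constant could depend on \<open>'a\<close>.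
  To keep it universal, one first asserts the existence of a constant for scalars (no type
  variable) and then that any such constant also serves for \<open>L\<^sub>p(M)\<close>-valued functions.\<close>

definition scalar_constant :: "real \<Rightarrow> bool" where
  "scalar_constant C \<longleftrightarrow> 0 < C \<and> scalar_bound C TYPE(real) \<and> scalar_bound C TYPE(complex)"

end

theory Submission
  imports Defs
begin

text \<open>Write \<open>P S h\<close> for \<open>cond_proj n S h\<close> and add the elements of the random set \<open>S\<close> one at a time, in random
order. Then \<open>P S h\<close> is a martingale that starts at the mean of \<open>h\<close>, which is 0, and the estimate is a
Rosenthal inequality with the optimal growth \<open>p / ln p\<close> for this martingale. Three features make it
elementary.

\<^item> The increment in direction \<open>j\<close> is \<open>P (S \<union> {j})\<close> applied to the \<open>j\<close>-th discrete derivative of \<open>h\<close>. It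
is odd in the \<open>j\<close>-th coordinate, so given the past it is symmetric, and its moment of order \<open>p\<close> is at
most that of the derivative (\<open>sign_coeff_eq_cond_proj_deriv\<close>, \<open>cond_proj_contraction\<close>).

\<^item> The increments in all directions outside \<open>S\<close> are Fourier coefficients of degree one of \<open>h\<close> on
a fiber. By the Bessel inequality the sum of their squares is at most \<open>P S\<close> of \<open>(norm h)\<^sup>2\<close>
(\<open>Bessel_sign_coeff\<close>), whose moment of order \<open>p/2\<close> is at most the \<open>p\<close>-th moment of \<open>h\<close>. This
controls the conditional variances at every single step.

\<^item> For a symmetric increment \<open>d\<close> of \<open>a\<close>, the average of \<open>norm (a \<plusminus> d) powr p\<close> exceeds \<open>norm a powr p\<close>
by at most a term quadratic in \<open>d\<close> if \<open>norm d \<le> norm a * ln p / (2 * p)\<close>, and otherwise is at most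
\<open>(3 * p / ln p) powr p * norm d powr p\<close> (\<open>two_point\<close>).

Together these give an affine recursion for the \<open>p\<close>-th moment in the size of the set
(\<open>proj_moment_step\<close>) with \<open>k\<close> steps, each adding terms of size \<open>1 / n\<close>, which yields the factors \<open>t = k / n\<close> and
\<open>sqrt t\<close>. The recursion is run for \<open>k \<le> n / 2\<close>; for larger \<open>k\<close> the term with \<open>sqrt t\<close> dominates
trivially.

For values in \<open>L\<^sub>p(M)\<close>, both sides are built from \<open>L\<^sub>p\<close> norms with the same exponent, so the scalar
estimate at almost every point of \<open>M\<close> can be integrated by the Minkowski inequality
(\<open>Lp_bound_if_scalar_bound\<close>), with the same constant.\<close>

section \<open>Averages over finite sets\<close>

lemma average_add: "average A (\<lambda>x. f x + g x) = average A f + average A g"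
  by (simp add: average_def sum.distrib scaleR_right_distrib)

lemma average_diff: "average A (\<lambda>x. f x - g x) = average A f - average A g"
  by (simp add: average_def sum_subtractf scaleR_right_diff_distrib)

lemma average_scaleR: "average A (\<lambda>x. c *\<^sub>R f x) = c *\<^sub>R average A f"
  by (simp add: average_def scaleR_right.sum scaleR_sum_right mult.commute)

lemma average_cmult: "average A (\<lambda>x. c * f x) = c * average A f" for c :: real
  using average_scaleR[of A c f] by simp

lemma average_sum: "average A (\<lambda>x. \<Sum>j\<in>J. f j x) = (\<Sum>j\<in>J. average A (f j))"
  unfolding average_def scaleR_sum_right by (rule sum.swap)

lemma average_cong: "(\<And>x. x \<in> A \<Longrightarrow> f x = g x) \<Longrightarrow> average A f = average A g"
  by (simp add: average_def cong: sum.cong)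

lemma average_mono:
  fixes f g :: "'i \<Rightarrow> real"
  shows "(\<And>x. x \<in> A \<Longrightarrow> f x \<le> g x) \<Longrightarrow> average A f \<le> average A g"
  by (simp add: average_def sum_mono divide_right_mono)

lemma average_nonneg:
  fixes f :: "'i \<Rightarrow> real"
  shows "(\<And>x. x \<in> A \<Longrightarrow> 0 \<le> f x) \<Longrightarrow> 0 \<le> average A f"
  by (simp add: average_def sum_nonneg)

lemma average_const: "finite A \<Longrightarrow> A \<noteq> {} \<Longrightarrow> average A (\<lambda>_. c) = c"
  by (simp add: average_def sum_constant_scaleR)

lemma average_reindex: "bij_betw \<phi> A B \<Longrightarrow> average A (\<lambda>x. f (\<phi> x)) = average B f"
  by (simp add: average_def sum.reindex_bij_betw bij_betw_same_card)

lemma convex_on_powr_nonneg: "convex_on {0..} (\<lambda>x::real. x powr q)" if "1 \<le> q"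
proof (rule convex_on_linorderI)
  fix t x y :: real
  assume *: "0 < t" "t < 1" "x \<in> {0..}" "y \<in> {0..}" "x < y"
  show "((1 - t) *\<^sub>R x + t *\<^sub>R y) powr q \<le> (1 - t) * x powr q + t * y powr q"
  proof (cases "x = 0")
    case True
    have "t powr q \<le> t powr 1" using * that by (intro powr_mono') auto
    then show ?thesis using * True by (simp add: powr_mult mult_right_mono)
  next
    case False
    then show ?thesis using * convex_onD[OF powr_convex[OF that], of t x y] by auto
  qed
qed simp

lemma Jensen_powr_average:
  fixes f :: "'i \<Rightarrow> real"
  assumes "finite A" "A \<noteq> {}" "1 \<le> q" "\<And>x. x \<in> A \<Longrightarrow> 0 \<le> f x"
  shows "average A f powr q \<le> average A (\<lambda>x. f x powr q)"
proof -
  have "(\<Sum>x\<in>A. (1 / real (card A)) *\<^sub>R f x) powr q \<le> (\<Sum>x\<in>A. 1 / real (card A) * f x powr q)"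
    using assms by (intro convex_on_sum[OF assms(1,2) convex_on_powr_nonneg]) auto
  then show ?thesis
    by (simp add: average_def sum_divide_distrib)
qed

lemma norm_average_powr_le:
  fixes f :: "'i \<Rightarrow> 'b::real_normed_vector"
  assumes "finite A" "A \<noteq> {}" "1 \<le> q"
  shows "norm (average A f) powr q \<le> average A (\<lambda>x. norm (f x) powr q)"
proof -
  have "norm (average A f) \<le> average A (\<lambda>x. norm (f x))"
    by (auto simp: average_def intro!: divide_right_mono norm_sum)
  then have "norm (average A f) powr q \<le> average A (\<lambda>x. norm (f x)) powr q"
    using assms by (intro powr_mono2) auto
  also have "\<dots> \<le> average A (\<lambda>x. norm (f x) powr q)"
    by (rule Jensen_powr_average) (use assms in auto)
  finally show ?thesis .
qed

text \<open>The square of the distance from \<open>h\<close> to its projection \<open>g\<close> onto the span of the \<open>\<phi> j\<close> is nonnegative,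
and \<open>\<langle>h, g\<rangle>\<close> and \<open>\<langle>g, g\<rangle>\<close> both equal the sum of the squared coefficients.\<close>
lemma Bessel_average:
  fixes h :: "'i \<Rightarrow> 'b::real_inner" and \<phi> :: "'j \<Rightarrow> 'i \<Rightarrow> real"
  assumes "finite J" "finite F" "F \<noteq> {}"
    and one: "\<And>j x. j \<in> J \<Longrightarrow> x \<in> F \<Longrightarrow> \<phi> j x * \<phi> j x = 1"
    and orth: "\<And>i j. i \<in> J \<Longrightarrow> j \<in> J \<Longrightarrow> i \<noteq> j \<Longrightarrow> average F (\<lambda>x. \<phi> i x * \<phi> j x) = 0"
  shows "(\<Sum>j\<in>J. (norm (average F (\<lambda>x. \<phi> j x *\<^sub>R h x)))\<^sup>2) \<le> average F (\<lambda>x. (norm (h x))\<^sup>2)"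
proof -
  define b where "b j = average F (\<lambda>x. \<phi> j x *\<^sub>R h x)" for j
  define g where "g x = (\<Sum>j\<in>J. \<phi> j x *\<^sub>R b j)" for x
  have inner_average: "average F (\<lambda>x. f x \<bullet> c) = average F f \<bullet> c" for f :: "'i \<Rightarrow> 'b" and c
    by (simp add: average_def inner_sum_left)
  have hg: "average F (\<lambda>x. h x \<bullet> g x) = (\<Sum>j\<in>J. (norm (b j))\<^sup>2)"
  proof -
    have "average F (\<lambda>x. h x \<bullet> g x) = average F (\<lambda>x. \<Sum>j\<in>J. (\<phi> j x *\<^sub>R h x) \<bullet> b j)"
      by (simp add: g_def inner_sum_right)
    also have "\<dots> = (\<Sum>j\<in>J. b j \<bullet> b j)"
      by (simp only: average_sum inner_average b_def)
    finally show ?thesis by (simp add: power2_norm_eq_inner)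
  qed
  have gg: "average F (\<lambda>x. g x \<bullet> g x) = (\<Sum>j\<in>J. (norm (b j))\<^sup>2)"
  proof -
    have "average F (\<lambda>x. g x \<bullet> g x) = average F (\<lambda>x. \<Sum>i\<in>J. \<Sum>j\<in>J. (b i \<bullet> b j) * (\<phi> i x * \<phi> j x))"
      by (simp only: g_def inner_sum_left, simp only: inner_sum_right inner_scaleR_left inner_scaleR_right mult_ac)
    also have "\<dots> = (\<Sum>i\<in>J. \<Sum>j\<in>J. (b i \<bullet> b j) * average F (\<lambda>x. \<phi> i x * \<phi> j x))"
      by (simp only: average_sum average_cmult)
    also have "\<dots> = (\<Sum>i\<in>J. \<Sum>j\<in>J. if i = j then b i \<bullet> b j else 0)"
    proof (intro sum.cong refl)
      fix i j assume ij: "i \<in> J" "j \<in> J"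
      have "average F (\<lambda>x. \<phi> i x * \<phi> i x) = average F (\<lambda>x. 1)"
        using ij one by (intro average_cong) auto
      then have "average F (\<lambda>x. \<phi> i x * \<phi> i x) = 1"
        using assms by (simp add: average_const)
      then show "(b i \<bullet> b j) * average F (\<lambda>x. \<phi> i x * \<phi> j x) = (if i = j then b i \<bullet> b j else 0)"
        using orth[OF ij] by auto
    qed
    also have "\<dots> = (\<Sum>j\<in>J. (norm (b j))\<^sup>2)"
      using assms by (simp add: power2_norm_eq_inner)
    finally show ?thesis .
  qed
  have "0 \<le> average F (\<lambda>x. (h x - g x) \<bullet> (h x - g x))"
    by (intro average_nonneg) simp
  also have "\<dots> = average F (\<lambda>x. (norm (h x))\<^sup>2 + g x \<bullet> g x - 2 * (h x \<bullet> g x))"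
    by (intro average_cong) (simp add: power2_norm_eq_inner inner_diff inner_commute)
  also have "\<dots> = average F (\<lambda>x. (norm (h x))\<^sup>2) - (\<Sum>j\<in>J. (norm (b j))\<^sup>2)"
    by (simp add: average_add average_diff average_cmult hg gg)
  finally show ?thesis by (simp add: b_def)
qed

section \<open>A two-point inequality\<close>

text \<open>Uses \<open>2 * cosh x - 2 = exp x * (1 - exp (- x))\<^sup>2\<close> and \<open>1 - exp (- x) \<le> x\<close>.\<close>
lemma cosh_le_quadratic_exp: "cosh x \<le> 1 + x\<^sup>2 / 2 * exp x" if "0 \<le> x" for x :: real
proof -
  have "1 - exp (- x) \<le> x" using exp_ge_add_one_self[of "-x"] by simp
  moreover have "0 \<le> 1 - exp (-x)" using that by simp
  ultimately have "(1 - exp (- x))\<^sup>2 \<le> x\<^sup>2" by (intro power_mono)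
  then have "exp x * (1 - exp (- x))\<^sup>2 \<le> exp x * x\<^sup>2" by simp
  moreover have "exp x * (1 - exp (- x))\<^sup>2 = 2 * cosh x - 2"
    by (simp add: cosh_def power2_eq_square algebra_simps flip: exp_add)
  ultimately show ?thesis by (simp add: mult.commute)
qed

text \<open>For fixed norms of \<open>a\<close> and \<open>d\<close>, collinear vectors are the worst case. The squares of \<open>norm (a + d)\<close> and
\<open>norm (a - d)\<close> have a sum that does not depend on the inner product of \<open>a\<close> and \<open>d\<close>, so they are mirror-image
convex combinations of the squares of \<open>norm a + norm d\<close> and \<open>norm a - norm d\<close>; now
\<open>x \<mapsto> x powr (p/2)\<close> is convex.\<close>
lemma norm_parallelogram_powr:
  fixes a d :: "'b::real_inner"
  assumes "2 \<le> p" "norm d \<le> norm a"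
  shows "norm (a + d) powr p + norm (a - d) powr p
    \<le> (norm a + norm d) powr p + (norm a - norm d) powr p"
proof -
  define u where "u = (norm a + norm d)\<^sup>2"
  define v where "v = (norm a - norm d)\<^sup>2"
  define B0 where "B0 = norm a * norm d"
  \<comment> \<open>The convex weight: \<open>w\<close> runs from 0 to 1 as \<open>a \<bullet> d\<close> runs from \<open>B0\<close> to \<open>- B0\<close>.\<close>
  define w where "w = (if B0 = 0 then 0 else (B0 - a \<bullet> d) / (2 * B0))"
  have pw: "x powr p = x\<^sup>2 powr (p/2)" if "0 \<le> x" for x :: real
    using that powr_powr[of x 2 "p/2"] by simp
  have CS: "\<bar>a \<bullet> d\<bar> \<le> B0" using Cauchy_Schwarz_ineq2[of a d] by (simp add: B0_def)
  have B0: "0 \<le> B0" by (simp add: B0_def)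
  have w: "0 \<le> w" "w \<le> 1" using CS B0 by (auto simp: w_def field_simps)
  have wB: "2 * (w * B0) = B0 - a \<bullet> d" using CS by (auto simp: w_def)
  have uv: "u = v + 4 * B0" by (simp add: u_def v_def B0_def power2_eq_square algebra_simps)
  have nplus: "(norm (a + d))\<^sup>2 = (1 - w) *\<^sub>R u + w *\<^sub>R v"
  proof -
    have "(norm (a + d))\<^sup>2 = (norm a)\<^sup>2 + (norm d)\<^sup>2 + 2 * (a \<bullet> d)"
      by (simp add: power2_norm_eq_inner inner_add inner_commute)
    also have "\<dots> = u - 4 * (w * B0)" using wB by (simp add: u_def B0_def power2_sum)
    finally show ?thesis by (simp add: uv algebra_simps)
  qed
  have nminus: "(norm (a - d))\<^sup>2 = (1 - w) *\<^sub>R v + w *\<^sub>R u"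
  proof -
    have "(norm (a - d))\<^sup>2 = (norm a)\<^sup>2 + (norm d)\<^sup>2 - 2 * (a \<bullet> d)"
      by (simp add: power2_norm_eq_inner inner_diff inner_commute)
    also have "\<dots> = v + 4 * (w * B0)" using wB by (simp add: v_def B0_def power2_diff)
    finally show ?thesis by (simp add: uv algebra_simps)
  qed
  have cvx: "convex_on {0..} (\<lambda>x::real. x powr (p/2))" using assms by (intro convex_on_powr_nonneg) simp
  have "(norm (a + d))\<^sup>2 powr (p/2) \<le> (1 - w) * u powr (p/2) + w * v powr (p/2)"
    unfolding nplus using w by (intro convex_onD[OF cvx]) (auto simp: u_def v_def)
  moreover have "(norm (a - d))\<^sup>2 powr (p/2) \<le> (1 - w) * v powr (p/2) + w * u powr (p/2)"
    unfolding nminus using w by (intro convex_onD[OF cvx]) (auto simp: u_def v_def)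
  ultimately have "(norm (a + d))\<^sup>2 powr (p/2) + (norm (a - d))\<^sup>2 powr (p/2)
      \<le> u powr (p/2) + v powr (p/2)" by (simp add: algebra_simps)
  then show ?thesis using assms(2) by (simp add: pw u_def v_def)
qed

text \<open>This is where \<open>p / ln p\<close> comes from. Call an increment \<open>d\<close> large if \<open>norm d / norm a\<close> exceeds
\<open>ln p / (2 * p)\<close>. If it is large, then \<open>norm a + norm d\<close> is at most \<open>3 * p / ln p\<close> times \<open>norm d\<close>, and the
last term suffices. If it is small, then, with \<open>u = norm d / norm a\<close>, the left-hand side divided by
\<open>norm a powr p\<close> is at most \<open>cosh (p * u)\<close>, whose excess over 1 is at most
\<open>(p * u)\<^sup>2 / 2 * exp (p * u)\<close>, and the threshold gives \<open>exp (p * u) \<le> sqrt p\<close>. The resulting power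
\<open>5/2\<close> of \<open>p\<close> is affordable, as any exponent \<open>q < 3\<close> would be: it enters the final estimate as \<open>p powr ((q - 1) / 2)\<close>, here
\<open>p powr (3/4)\<close>, which is \<open>O(p / ln p)\<close>.\<close>
lemma two_point:
  fixes a d :: "'b::real_inner"
  assumes p: "2 \<le> p"
  shows "(norm (a + d) powr p + norm (a - d) powr p) / 2
    \<le> norm a powr p + p powr (5/2) / 2 * (norm a powr (p - 2) * (norm d)\<^sup>2)
      + (3 * p / ln p) powr p * norm d powr p"
proof -
  have lnp: "0 < ln p" "ln p \<le> p" using p ln_le_minus_one[of p] by auto
  show ?thesis
  proof (cases "norm d * (2 * p) \<le> norm a * ln p")
    case False
    have "norm a + norm d \<le> norm d * (2 * p) / ln p + norm d * (p / ln p)"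
    proof (rule add_mono)
      show "norm a \<le> norm d * (2 * p) / ln p" using False lnp by (simp add: field_simps)
      show "norm d \<le> norm d * (p / ln p)"
        using lnp mult_left_mono[of 1 "p / ln p" "norm d"] by simp
    qed
    also have "\<dots> = 3 * p / ln p * norm d" by (simp add: field_simps)
    finally have le: "norm a + norm d \<le> 3 * p / ln p * norm d" .
    have "norm (a + d) powr p \<le> (3 * p / ln p * norm d) powr p"
      using p order_trans[OF norm_triangle_ineq le] by (intro powr_mono2) simp_all
    moreover have "norm (a - d) powr p \<le> (3 * p / ln p * norm d) powr p"
      using p order_trans[OF norm_triangle_ineq4 le] by (intro powr_mono2) simp_all
    ultimately have "(norm (a + d) powr p + norm (a - d) powr p) / 2
        \<le> (3 * p / ln p * norm d) powr p" by simp
    also have "\<dots> = (3 * p / ln p) powr p * norm d powr p"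
      by (simp only: powr_mult)
    finally show ?thesis using p by (simp add: add_increasing)
  next
    case True
    show ?thesis
    proof (cases "a = 0")
      case True
      then have "d = 0" using \<open>norm d * (2 * p) \<le> norm a * ln p\<close> p by (simp add: mult_le_0_iff)
      then show ?thesis using True by simp
    next
      case False
      define r where "r = norm a"
      define u where "u = norm d / r"
      have r: "0 < r" using False by (simp add: r_def)
      have d: "norm d = r * u" using r by (simp add: u_def)
      have u0: "0 \<le> u" using r by (simp add: u_def)
      have pu: "2 * (p * u) \<le> ln p" using True r by (simp add: d r_def[symmetric] mult_ac)
      have "p * u \<le> p * 1" using pu lnp by linarith
      then have u1: "u \<le> 1" using p by simp
      have "exp (p * u) \<le> exp (ln p / 2)" using pu by simp
      also have "\<dots> = p powr (1/2)" using p by (simp add: powr_def)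
      finally have expu: "exp (p * u) \<le> p powr (1/2)" .
      have "(norm a + norm d) powr p + (norm a - norm d) powr p
          = r powr p * ((1 + u) powr p + (1 - u) powr p)"
      proof -
        have *: "norm a + norm d = r * (1 + u)" "norm a - norm d = r * (1 - u)"
          by (simp_all add: d r_def[symmetric] algebra_simps)
        show ?thesis unfolding * powr_mult by (rule distrib_left[symmetric])
      qed
      also have "\<dots> \<le> r powr p * (exp (p * u) + exp (- (p * u)))"
      proof -
        have "(1 + u) powr p \<le> exp u powr p" using u0 p by (intro powr_mono2) auto
        moreover have "(1 - u) powr p \<le> exp (-u) powr p"
          using u1 p exp_ge_add_one_self[of "-u"] by (intro powr_mono2) auto
        ultimately show ?thesis using r by (intro mult_left_mono add_mono) (auto simp: powr_def)
      qed
      also have "\<dots> = 2 * (r powr p * cosh (p * u))" by (simp add: cosh_def)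
      also have "\<dots> \<le> 2 * (r powr p * (1 + (p * u)\<^sup>2 / 2 * p powr (1/2)))"
        using cosh_le_quadratic_exp[of "p * u"] u0 p expu
        by (intro mult_left_mono order_trans[OF cosh_le_quadratic_exp] add_left_mono) auto
      also have "\<dots> = 2 * (r powr p + p powr (5/2) / 2 * (r powr (p - 2) * (norm d)\<^sup>2))"
      proof -
        have "p powr (5/2) = p\<^sup>2 * p powr (1/2)"
          using p powr_add[of p 2 "1/2"] by simp
        moreover have "r powr p = r powr (p - 2) * r\<^sup>2"
          using r powr_add[of r "p - 2" 2] by simp
        ultimately show ?thesis by (simp add: d power_mult_distrib algebra_simps)
      qed
      finally have "(norm a + norm d) powr p + (norm a - norm d) powr p
        \<le> 2 * (r powr p + p powr (5/2) / 2 * (r powr (p - 2) * (norm d)\<^sup>2))" .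
      moreover have "norm d \<le> norm a" using d u1 r by (simp add: r_def)
      note norm_parallelogram_powr[OF p this]
      ultimately have le2: "norm (a + d) powr p + norm (a - d) powr p
          \<le> 2 * (r powr p + p powr (5/2) / 2 * (r powr (p - 2) * (norm d)\<^sup>2))"
        by (meson order_trans)
      have half: "x / 2 \<le> z" if "x \<le> 2 * z" for x z :: real using that by simp
      from half[OF le2] have "(norm (a + d) powr p + norm (a - d) powr p) / 2
          \<le> r powr p + p powr (5/2) / 2 * (r powr (p - 2) * (norm d)\<^sup>2)" .
      then show ?thesis using p by (simp add: r_def add_increasing2)
    qed
  qed
qed

text \<open>Whichever of \<open>b\<close> and \<open>\<mu> * a\<^sup>2\<close> is larger dominates the product by one of the two summands. In
contrast to the Hoelder inequality, this keeps the recursion for the moments linear.\<close>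
lemma crude_Young:
  fixes a b :: real
  assumes "2 \<le> p" "0 < \<mu>" "0 \<le> a" "0 \<le> b"
  shows "a powr (p - 2) * b \<le> \<mu> * a powr p + \<mu> powr (1 - p/2) * b powr (p/2)"
proof (cases "b \<le> \<mu> * a\<^sup>2")
  case True
  have "a powr (p - 2) * b \<le> a powr (p - 2) * (\<mu> * a\<^sup>2)" using True by (intro mult_left_mono) auto
  also have "\<dots> = \<mu> * a powr p"
    using assms powr_add[of a "p - 2" 2] by (cases "a = 0") simp_all
  finally show ?thesis by (simp add: add_increasing2)
next
  case False
  then have b: "0 < b" using assms by (smt (verit) mult_nonneg_nonneg zero_le_power2)
  have "a powr (p - 2) = (a\<^sup>2) powr (p/2 - 1)"
    using assms powr_powr[of a 2 "p/2 - 1"] by (simp add: algebra_simps)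
  also have "\<dots> \<le> (b / \<mu>) powr (p/2 - 1)"
    using False assms by (intro powr_mono2) (auto simp: field_simps)
  finally have "a powr (p - 2) * b \<le> (b / \<mu>) powr (p/2 - 1) * b" using b by simp
  also have "\<dots> = \<mu> powr (1 - p/2) * b powr (p/2)"
  proof -
    have "b powr (p/2) = b powr (p/2 - 1) * b" using b powr_add[of b "p/2 - 1" 1] by simp
    moreover have "(b / \<mu>) powr (p/2 - 1) = \<mu> powr (1 - p/2) * b powr (p/2 - 1)"
      using b assms powr_minus_divide[of \<mu> "p/2 - 1"] powr_divide[of b \<mu> "p/2 - 1"] by simp
    ultimately show ?thesis by simp
  qed
  finally show ?thesis using assms by (simp add: add_increasing)
qed

section \<open>Conditional expectations on the cube\<close>

definition cube_fiber :: "nat \<Rightarrow> nat set \<Rightarrow> (nat \<Rightarrow> int) \<Rightarrow> (nat \<Rightarrow> int) set" where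
  "cube_fiber n S \<epsilon> = {\<eta> \<in> cube n. \<forall>j\<in>S. \<eta> j = \<epsilon> j}"

lemma cond_proj_eq: "cond_proj n S h \<epsilon> = average (cube_fiber n S \<epsilon>) h"
  by (simp add: cond_proj_def cube_fiber_def)

lemma finite_cube [simp]: "finite (cube n)"
  by (simp add: cube_def finite_PiE)

lemma cube_nonempty [simp]: "cube n \<noteq> {}"
  by (simp add: cube_def PiE_eq_empty_iff)

lemma finite_cube_fiber [simp]: "finite (cube_fiber n S \<epsilon>)"
  by (simp add: cube_fiber_def)

lemma cube_fiber_subset: "\<eta> \<in> cube_fiber n S \<epsilon> \<Longrightarrow> \<eta> \<in> cube n"
  by (simp add: cube_fiber_def)

lemma self_in_cube_fiber: "\<epsilon> \<in> cube n \<Longrightarrow> \<epsilon> \<in> cube_fiber n S \<epsilon>"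
  by (simp add: cube_fiber_def)

lemma cube_fiber_nonempty: "\<epsilon> \<in> cube n \<Longrightarrow> cube_fiber n S \<epsilon> \<noteq> {}"
  using self_in_cube_fiber by blast

lemma cube_fiber_cong: "\<eta> \<in> cube_fiber n S \<epsilon> \<Longrightarrow> cube_fiber n S \<eta> = cube_fiber n S \<epsilon>"
  by (auto simp: cube_fiber_def)

lemma cube_coord: "\<epsilon> \<in> cube n \<Longrightarrow> j \<in> {1..n} \<Longrightarrow> \<epsilon> j = -1 \<or> \<epsilon> j = 1"
  unfolding cube_def by (drule PiE_mem, assumption) auto

lemma flip_coord_invol [simp]: "flip_coord j (flip_coord j \<epsilon>) = \<epsilon>"
  by (simp add: flip_coord_def)

lemma flip_coord_in_cube: "j \<in> {1..n} \<Longrightarrow> \<epsilon> \<in> cube n \<Longrightarrow> flip_coord j \<epsilon> \<in> cube n"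
  unfolding cube_def by (auto simp: flip_coord_def PiE_iff extensional_def)

lemma bij_betw_flip_coord_cube: "j \<in> {1..n} \<Longrightarrow> bij_betw (flip_coord j) (cube n) (cube n)"
  by (rule bij_betwI[of _ _ _ "flip_coord j"]) (auto intro: flip_coord_in_cube)

lemma bij_betw_flip_coord_fiber:
  "j \<in> {1..n} \<Longrightarrow> bij_betw (flip_coord j) (cube_fiber n S \<epsilon>) (cube_fiber n S (flip_coord j \<epsilon>))"
  by (rule bij_betwI[of _ _ _ "flip_coord j"])
    (auto simp: cube_fiber_def intro: flip_coord_in_cube, auto simp: flip_coord_def split: if_splits)

lemma cube_fiber_flip: "j \<notin> S \<Longrightarrow> cube_fiber n S (flip_coord j \<epsilon>) = cube_fiber n S \<epsilon>"
  by (auto simp: cube_fiber_def flip_coord_def split: if_splits)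

text \<open>The fibers partition the cube, so after exchanging the two sums each \<open>f \<eta>\<close> is counted once for every
point of its own fiber, with weight one over the size of that fiber.\<close>
lemma average_cond_proj: "average (cube n) (cond_proj n S f) = average (cube n) f"
proof -
  have "(\<Sum>\<epsilon>\<in>cube n. cond_proj n S f \<epsilon>)
      = (\<Sum>\<epsilon>\<in>cube n. \<Sum>\<eta>\<in>{\<eta> \<in> cube n. \<forall>j\<in>S. \<eta> j = \<epsilon> j}. (1 / real (card (cube_fiber n S \<epsilon>))) *\<^sub>R f \<eta>)"
    by (simp add: cond_proj_eq average_def scaleR_sum_right flip: cube_fiber_def)
  also have "\<dots> = (\<Sum>\<eta>\<in>cube n. \<Sum>\<epsilon>\<in>{\<epsilon> \<in> cube n. \<forall>j\<in>S. \<eta> j = \<epsilon> j}. (1 / real (card (cube_fiber n S \<epsilon>))) *\<^sub>R f \<eta>)"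
    by (rule sum.swap_restrict) auto
  also have "\<dots> = (\<Sum>\<eta>\<in>cube n. f \<eta>)"
  proof (rule sum.cong[OF refl])
    fix \<eta> assume \<eta>: "\<eta> \<in> cube n"
    have "{\<epsilon> \<in> cube n. \<forall>j\<in>S. \<eta> j = \<epsilon> j} = cube_fiber n S \<eta>"
      by (auto simp: cube_fiber_def)
    then have "(\<Sum>\<epsilon>\<in>{\<epsilon> \<in> cube n. \<forall>j\<in>S. \<eta> j = \<epsilon> j}. (1 / real (card (cube_fiber n S \<epsilon>))) *\<^sub>R f \<eta>)
        = (\<Sum>\<epsilon>\<in>cube_fiber n S \<eta>. (1 / real (card (cube_fiber n S \<eta>))) *\<^sub>R f \<eta>)"
      by (intro sum.cong) (auto simp: cube_fiber_cong)
    also have "\<dots> = f \<eta>"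
      using cube_fiber_nonempty[OF \<eta>, of S] by (simp add: sum_constant_scaleR)
    finally show "(\<Sum>\<epsilon>\<in>{\<epsilon> \<in> cube n. \<forall>j\<in>S. \<eta> j = \<epsilon> j}. (1 / real (card (cube_fiber n S \<epsilon>))) *\<^sub>R f \<eta>) = f \<eta>" .
  qed
  finally show ?thesis by (simp add: average_def)
qed

lemma cond_proj_contraction:
  fixes f :: "(nat \<Rightarrow> int) \<Rightarrow> 'b::real_normed_vector"
  assumes "1 \<le> q"
  shows "average (cube n) (\<lambda>\<epsilon>. norm (cond_proj n S f \<epsilon>) powr q) \<le> average (cube n) (\<lambda>\<epsilon>. norm (f \<epsilon>) powr q)"
proof -
  have "average (cube n) (\<lambda>\<epsilon>. norm (cond_proj n S f \<epsilon>) powr q)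
      \<le> average (cube n) (cond_proj n S (\<lambda>\<epsilon>. norm (f \<epsilon>) powr q))"
    unfolding cond_proj_eq
    by (intro average_mono norm_average_powr_le assms cube_fiber_nonempty) auto
  then show ?thesis by (simp add: average_cond_proj)
qed

lemma average_fiber_flip:
  fixes f :: "(nat \<Rightarrow> int) \<Rightarrow> 'b::real_vector"
  assumes "\<epsilon> \<in> cube n" "j \<in> {1..n}" "j \<notin> S"
  shows "average (cube_fiber n S \<epsilon>) (\<lambda>\<eta>. f (flip_coord j \<eta>)) = average (cube_fiber n S \<epsilon>) f"
  using average_reindex[OF bij_betw_flip_coord_fiber[of j n S \<epsilon>], of f] assms
  by (simp add: cube_fiber_flip)

text \<open>Flipping coordinate \<open>i\<close> preserves the fiber and changes the sign of the integrand.\<close>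
lemma sign_orthogonal:
  assumes "i \<in> {1..n}" "i \<notin> S" "i \<noteq> j" "\<epsilon> \<in> cube n"
  shows "average (cube_fiber n S \<epsilon>) (\<lambda>\<eta>. of_int (\<epsilon> i * \<eta> i) * of_int (\<epsilon> j * \<eta> j)) = (0::real)"
proof -
  let ?g = "\<lambda>\<eta>. of_int (\<epsilon> i * \<eta> i) * of_int (\<epsilon> j * \<eta> j) :: real"
  have "average (cube_fiber n S \<epsilon>) ?g = average (cube_fiber n S \<epsilon>) (\<lambda>\<eta>. ?g (flip_coord i \<eta>))"
    using average_fiber_flip[OF assms(4,1,2), of ?g] by (rule sym)
  also have "\<dots> = average (cube_fiber n S \<epsilon>) (\<lambda>\<eta>. (-1) * ?g \<eta>)"
    using assms by (intro average_cong) (simp add: flip_coord_def)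
  also have "\<dots> = - average (cube_fiber n S \<epsilon>) ?g"
    by (subst average_cmult) simp
  finally show ?thesis by simp
qed

text \<open>The increment of \<open>cond_proj n S h\<close> when \<open>j\<close> is added to \<open>S\<close>. It equals \<open>\<epsilon> j\<close> times the
coefficient of degree one in direction \<open>j\<close> of \<open>h\<close> restricted to the fiber, which makes the Bessel
inequality applicable; the factor \<open>\<epsilon> j\<close> makes it odd in coordinate \<open>j\<close>.\<close>
definition sign_coeff :: "nat \<Rightarrow> nat set \<Rightarrow> nat \<Rightarrow> ((nat \<Rightarrow> int) \<Rightarrow> 'b::real_vector) \<Rightarrow> (nat \<Rightarrow> int) \<Rightarrow> 'b" where
  "sign_coeff n S j h \<epsilon> = average (cube_fiber n S \<epsilon>) (\<lambda>\<eta>. of_int (\<epsilon> j * \<eta> j) *\<^sub>R h \<eta>)"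

text \<open>The weight \<open>1 + \<epsilon> j * \<eta> j\<close> is 2 on the half of the fiber that agrees with \<open>\<epsilon>\<close> at \<open>j\<close>, and 0 on the other half.\<close>
lemma cond_proj_insert:
  fixes h :: "(nat \<Rightarrow> int) \<Rightarrow> 'b::real_vector"
  assumes \<epsilon>: "\<epsilon> \<in> cube n" and j: "j \<in> {1..n}" "j \<notin> S"
  shows "cond_proj n (insert j S) h \<epsilon> = cond_proj n S h \<epsilon> + sign_coeff n S j h \<epsilon>"
proof -
  let ?F = "cube_fiber n S \<epsilon>" and ?G = "cube_fiber n (insert j S) \<epsilon>"
  let ?G' = "cube_fiber n (insert j S) (flip_coord j \<epsilon>)"
  have F: "?F = ?G \<union> ?G'" "?G \<inter> ?G' = {}"
  proof -
    have *: "\<eta> j = \<epsilon> j \<or> \<eta> j = - \<epsilon> j" if "\<eta> \<in> cube n" for \<eta>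
      using cube_coord[OF that j(1)] cube_coord[OF \<epsilon> j(1)] by auto
    show "?F = ?G \<union> ?G'" using * j
      by (auto simp: cube_fiber_def flip_coord_def split: if_splits)
    show "?G \<inter> ?G' = {}" using cube_coord[OF \<epsilon> j(1)]
      by (auto simp: cube_fiber_def flip_coord_def)
  qed
  have "card ?G' = card ?G"
    using bij_betw_same_card[OF bij_betw_flip_coord_fiber[OF j(1)]] by metis
  then have card: "real (card ?F) = 2 * real (card ?G)"
    unfolding F(1) using F(2) by (subst card_Un_disjoint) auto
  have "cond_proj n S h \<epsilon> + sign_coeff n S j h \<epsilon>
      = (1 / real (card ?F)) *\<^sub>R (\<Sum>\<eta>\<in>?F. (1 + of_int (\<epsilon> j * \<eta> j)) *\<^sub>R h \<eta>)"
    by (simp add: cond_proj_eq sign_coeff_def average_def scaleR_add_left sum.distrib scaleR_add_right)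
  also have "(\<Sum>\<eta>\<in>?F. (1 + of_int (\<epsilon> j * \<eta> j)) *\<^sub>R h \<eta>)
      = (\<Sum>\<eta>\<in>?G. (1 + of_int (\<epsilon> j * \<eta> j)) *\<^sub>R h \<eta>) + (\<Sum>\<eta>\<in>?G'. (1 + of_int (\<epsilon> j * \<eta> j)) *\<^sub>R h \<eta>)"
    unfolding F(1) using F(2) by (subst sum.union_disjoint) auto
  also have "(\<Sum>\<eta>\<in>?G. (1 + of_int (\<epsilon> j * \<eta> j)) *\<^sub>R h \<eta>) = (\<Sum>\<eta>\<in>?G. 2 *\<^sub>R h \<eta>)"
    using cube_coord[OF \<epsilon> j(1)] by (intro sum.cong) (auto simp: cube_fiber_def)
  also have "(\<Sum>\<eta>\<in>?G'. (1 + of_int (\<epsilon> j * \<eta> j)) *\<^sub>R h \<eta>) = 0"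
    using cube_coord[OF \<epsilon> j(1)] by (intro sum.neutral) (auto simp: cube_fiber_def flip_coord_def)
  finally show ?thesis
    by (simp add: card cond_proj_eq average_def flip: scaleR_sum_right)
qed

lemma sign_coeff_flip:
  assumes "j \<notin> S"
  shows "sign_coeff n S j h (flip_coord j \<epsilon>) = - sign_coeff n S j h \<epsilon>"
  using assms by (simp add: sign_coeff_def cube_fiber_flip average_def sum_negf) (simp add: flip_coord_def sum_negf)

lemma cond_proj_flip: "j \<notin> S \<Longrightarrow> cond_proj n S h (flip_coord j \<epsilon>) = cond_proj n S h \<epsilon>"
  by (simp add: cond_proj_eq cube_fiber_flip)

lemma cond_proj_insert_flip:
  assumes "\<epsilon> \<in> cube n" "j \<in> {1..n}" "j \<notin> S"
  shows "cond_proj n (insert j S) h (flip_coord j \<epsilon>) = cond_proj n S h \<epsilon> - sign_coeff n S j h \<epsilon>"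
  using assms by (simp add: cond_proj_insert flip_coord_in_cube cond_proj_flip sign_coeff_flip)

text \<open>Through this identity the contraction property bounds the large increments by the norms of \<open>discrete_deriv j h\<close>.\<close>
lemma sign_coeff_eq_cond_proj_deriv:
  fixes h :: "(nat \<Rightarrow> int) \<Rightarrow> 'b::real_vector"
  assumes \<epsilon>: "\<epsilon> \<in> cube n" and j: "j \<in> {1..n}" "j \<notin> S"
  shows "sign_coeff n S j h \<epsilon> = cond_proj n (insert j S) (discrete_deriv j h) \<epsilon>"
proof -
  have "cond_proj n (insert j S) (discrete_deriv j h) \<epsilon>
      = (1/2) *\<^sub>R (cond_proj n (insert j S) h \<epsilon> - average (cube_fiber n (insert j S) \<epsilon>) (\<lambda>\<eta>. h (flip_coord j \<eta>)))"
    unfolding cond_proj_eq discrete_deriv_def average_scaleR average_diff ..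
  also have "average (cube_fiber n (insert j S) \<epsilon>) (\<lambda>\<eta>. h (flip_coord j \<eta>))
      = cond_proj n (insert j S) h (flip_coord j \<epsilon>)"
    unfolding cond_proj_eq by (rule average_reindex[OF bij_betw_flip_coord_fiber[OF j(1)]])
  finally show ?thesis
    using assms by (simp add: cond_proj_insert cond_proj_insert_flip flip: scaleR_2)
qed

text \<open>All increments out of \<open>S\<close> are controlled together by the conditional second moment of \<open>h\<close>. In the
martingale picture, their sum of squares is the conditional variance up to a factor.\<close>
lemma Bessel_sign_coeff:
  fixes h :: "(nat \<Rightarrow> int) \<Rightarrow> 'b::real_inner"
  assumes \<epsilon>: "\<epsilon> \<in> cube n"
  shows "(\<Sum>j\<in>{1..n}-S. (norm (sign_coeff n S j h \<epsilon>))\<^sup>2) \<le> cond_proj n S (\<lambda>\<eta>. (norm (h \<eta>))\<^sup>2) \<epsilon>"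
  unfolding cond_proj_eq sign_coeff_def
proof (rule Bessel_average)
  show "of_int (\<epsilon> j * x j) * of_int (\<epsilon> j * x j) = (1::real)"
    if "j \<in> {1..n} - S" "x \<in> cube_fiber n S \<epsilon>" for j x
    using cube_coord[OF \<epsilon>, of j] cube_coord[OF cube_fiber_subset[OF that(2)], of j] that(1) by auto
  show "average (cube_fiber n S \<epsilon>) (\<lambda>x. of_int (\<epsilon> i * x i) * of_int (\<epsilon> j * x j)) = (0::real)"
    if "i \<in> {1..n} - S" "j \<in> {1..n} - S" "i \<noteq> j" for i j
    by (rule sign_orthogonal) (use that \<epsilon> in auto)
qed (use \<epsilon> cube_fiber_nonempty in auto)

text \<open>Given the coordinates in \<open>S\<close>, the increment is symmetric: averaging over \<open>\<epsilon>\<close> and its flip at \<open>j\<close>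
brings the moment into the form of the two-point inequality.\<close>
lemma average_powr_insert:
  fixes h :: "(nat \<Rightarrow> int) \<Rightarrow> 'b::real_inner"
  assumes j: "j \<in> {1..n}" "j \<notin> S"
  shows "average (cube n) (\<lambda>\<epsilon>. norm (cond_proj n (insert j S) h \<epsilon>) powr p)
    = average (cube n) (\<lambda>\<epsilon>. (norm (cond_proj n S h \<epsilon> + sign_coeff n S j h \<epsilon>) powr p
        + norm (cond_proj n S h \<epsilon> - sign_coeff n S j h \<epsilon>) powr p) / 2)"
proof -
  let ?f = "\<lambda>\<epsilon>. norm (cond_proj n (insert j S) h \<epsilon>) powr p"
  have "average (cube n) ?f = (average (cube n) ?f + average (cube n) (\<lambda>\<epsilon>. ?f (flip_coord j \<epsilon>))) / 2"
    by (simp add: average_reindex[OF bij_betw_flip_coord_cube[OF j(1)], of ?f])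
  also have "\<dots> = average (cube n) (\<lambda>\<epsilon>. (1/2) * (?f \<epsilon> + ?f (flip_coord j \<epsilon>)))"
    by (simp only: average_cmult average_add)
  also have "\<dots> = average (cube n) (\<lambda>\<epsilon>. (norm (cond_proj n S h \<epsilon> + sign_coeff n S j h \<epsilon>) powr p
        + norm (cond_proj n S h \<epsilon> - sign_coeff n S j h \<epsilon>) powr p) / 2)"
    using j by (intro average_cong) (simp add: cond_proj_insert cond_proj_insert_flip)
  finally show ?thesis .
qed

section \<open>The recursion for the moments of random projections\<close>

lemma finite_k_subsets [simp]: "finite (k_subsets n k)"
  by (rule finite_subset[of _ "Pow {1..n}"]) (auto simp: k_subsets_def)

lemma k_subsets_nonempty: "k \<le> n \<Longrightarrow> k_subsets n k \<noteq> {}"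
  using obtain_subset_with_card_n[of k "{1..n}"] by (auto simp: k_subsets_def)

lemma k_subsets_0 [simp]: "k_subsets n 0 = {{}}"
  by (auto simp: k_subsets_def dest: finite_subset)

text \<open>Double counting of the pairs \<open>(T, j)\<close> with \<open>j \<in> T\<close>, where \<open>S = T - {j}\<close>.\<close>
lemma sum_insert_k_subsets:
  fixes f :: "nat set \<Rightarrow> real"
  shows "(\<Sum>S\<in>k_subsets n i. \<Sum>j\<in>{1..n}-S. f (insert j S)) = real (Suc i) * (\<Sum>T\<in>k_subsets n (Suc i). f T)"
proof -
  have fin: "finite S" if "S \<in> k_subsets n m" for S m
    using that by (auto simp: k_subsets_def intro: finite_subset)
  have "(\<Sum>S\<in>k_subsets n i. \<Sum>j\<in>{1..n}-S. f (insert j S))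
      = (\<Sum>(S,j)\<in>Sigma (k_subsets n i) (\<lambda>S. {1..n}-S). f (insert j S))"
    by (rule sum.Sigma) auto
  also have "\<dots> = (\<Sum>(T,j)\<in>Sigma (k_subsets n (Suc i)) (\<lambda>T. T). f T)"
    by (rule sum.reindex_bij_witness[of _ "\<lambda>(T,j). (T - {j}, j)" "\<lambda>(S,j). (insert j S, j)"])
      (auto simp: k_subsets_def insert_absorb card_insert_if finite_subset[of _ "{Suc 0..n}"])
  also have "\<dots> = (\<Sum>T\<in>k_subsets n (Suc i). \<Sum>j\<in>T. f T)"
    by (rule sum.Sigma[symmetric]) (auto simp: fin)
  also have "\<dots> = real (Suc i) * (\<Sum>T\<in>k_subsets n (Suc i). f T)"
    by (simp add: k_subsets_def sum_distrib_left)
  finally show ?thesis .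
qed

text \<open>A random set of size \<open>i + 1\<close> arises from one of size \<open>i\<close> by adding a uniformly chosen new element.\<close>
lemma average_k_subsets_Suc:
  fixes f :: "nat set \<Rightarrow> real"
  assumes "i < n"
  shows "average (k_subsets n (Suc i)) f
    = average (k_subsets n i) (\<lambda>S. 1 / real (n - i) * (\<Sum>j\<in>{1..n}-S. f (insert j S)))"
proof -
  have "card ({1..n} - S) = n - i" if "S \<in> k_subsets n i" for S
    using that by (subst card_Diff_subset) (auto simp: k_subsets_def intro: finite_subset)
  then have card: "real (n - i) * real (card (k_subsets n i)) = real (Suc i) * real (card (k_subsets n (Suc i)))"
    using sum_insert_k_subsets[of "\<lambda>_. 1" n i] by (simp add: mult.commute)
  have "card (k_subsets n i) \<noteq> 0" "card (k_subsets n (Suc i)) \<noteq> 0"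
    using assms k_subsets_nonempty by auto
  then have "1 / (real (n - i) * real (card (k_subsets n i))) * real (Suc i) = 1 / real (card (k_subsets n (Suc i)))"
    unfolding card by simp
  then have e: "1 / real (card (k_subsets n (Suc i))) = 1 / (real (n - i) * real (card (k_subsets n i))) * real (Suc i)"
    by (rule sym)
  show ?thesis
    unfolding average_def sum_distrib_left[symmetric] sum_insert_k_subsets e by simp
qed

definition proj_moment :: "nat \<Rightarrow> real \<Rightarrow> ((nat \<Rightarrow> int) \<Rightarrow> 'b::real_normed_vector) \<Rightarrow> nat \<Rightarrow> real" where
  "proj_moment n p h i
    = average (k_subsets n i) (\<lambda>S. average (cube n) (\<lambda>\<epsilon>. norm (cond_proj n S h \<epsilon>) powr p))"

text \<open>For each \<open>S\<close>, the two-point inequality is summed over the new elements \<open>j\<close>. The sum of the squared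
increments is at most \<open>cond_proj n S\<close> of \<open>(norm h)\<^sup>2\<close> by Bessel; separated from the factor
\<open>norm (cond_proj n S h) powr (p - 2)\<close> by the Young inequality, it contributes at most the \<open>p\<close>-th
moment of \<open>h\<close>, since \<open>cond_proj\<close> contracts the norm with exponent \<open>p/2 \<ge> 1\<close>. The hypothesis
\<open>2 * i \<le> n\<close> bounds the probability \<open>1 / (n - i)\<close> of a new element by \<open>2 / n\<close>.\<close>
lemma proj_moment_step:
  fixes h :: "(nat \<Rightarrow> int) \<Rightarrow> 'b::real_inner"
  assumes p: "2 \<le> p" and i: "i < n" "2 * i \<le> n" and \<mu>: "0 < \<mu>"
  shows "proj_moment n p h (Suc i) \<le> proj_moment n p h i
    + 2 / real n * (p powr (5/2) / 2 * (\<mu> * proj_moment n p h i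
          + \<mu> powr (1 - p/2) * average (cube n) (\<lambda>\<epsilon>. norm (h \<epsilon>) powr p))
        + (3 * p / ln p) powr p
          * (\<Sum>j=1..n. average (cube n) (\<lambda>\<epsilon>. norm (discrete_deriv j h \<epsilon>) powr p)))"
proof -
  define B where "B = p powr (5/2) / 2"
  define Y where "Y = (3 * p / ln p) powr p"
  define H where "H = average (cube n) (\<lambda>\<epsilon>. norm (h \<epsilon>) powr p)"
  define D where "D = (\<Sum>j=1..n. average (cube n) (\<lambda>\<epsilon>. norm (discrete_deriv j h \<epsilon>) powr p))"
  define x where "x S = average (cube n) (\<lambda>\<epsilon>. norm (cond_proj n S h \<epsilon>) powr p)" for S
  have B: "0 \<le> B" and Y: "0 \<le> Y" by (simp_all add: B_def Y_def)
  have H: "0 \<le> H" and D: "0 \<le> D" and x: "0 \<le> x S" for S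
    by (auto simp: H_def D_def x_def intro!: average_nonneg sum_nonneg)
  have single: "1 / real (n - i) * (\<Sum>j\<in>{1..n}-S. x (insert j S))
      \<le> x S + 2 / real n * (B * (\<mu> * x S + \<mu> powr (1 - p/2) * H) + Y * D)"
    if S: "S \<in> k_subsets n i" for S
  proof -
    define J where "J = {1..n} - S"
    define a where "a \<epsilon> = norm (cond_proj n S h \<epsilon>)" for \<epsilon>
    define d where "d j \<epsilon> = norm (sign_coeff n S j h \<epsilon>)" for j \<epsilon>
    have cardJ: "card J = n - i"
      unfolding J_def using S by (subst card_Diff_subset) (auto simp: k_subsets_def intro: finite_subset)
    have "(\<Sum>j\<in>J. x (insert j S))
        \<le> (\<Sum>j\<in>J. average (cube n) (\<lambda>\<epsilon>. a \<epsilon> powr p + B * (a \<epsilon> powr (p - 2) * (d j \<epsilon>)\<^sup>2) + Y * d j \<epsilon> powr p))"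
      using two_point[OF p] unfolding x_def a_def d_def B_def Y_def
      by (intro sum_mono) (auto simp: J_def average_powr_insert intro!: average_mono)
    also have "\<dots> = real (card J) * x S
        + B * average (cube n) (\<lambda>\<epsilon>. a \<epsilon> powr (p - 2) * (\<Sum>j\<in>J. (d j \<epsilon>)\<^sup>2))
        + Y * (\<Sum>j\<in>J. average (cube n) (\<lambda>\<epsilon>. d j \<epsilon> powr p))"
      by (simp add: average_add average_cmult sum.distrib x_def a_def average_sum sum_distrib_left)
    also have "\<dots> \<le> real (card J) * x S + B * (\<mu> * x S + \<mu> powr (1 - p/2) * H) + Y * D"
    proof (intro add_mono mult_left_mono order_refl)
      have "average (cube n) (\<lambda>\<epsilon>. a \<epsilon> powr (p - 2) * (\<Sum>j\<in>J. (d j \<epsilon>)\<^sup>2))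
          \<le> average (cube n) (\<lambda>\<epsilon>. \<mu> * a \<epsilon> powr p
              + \<mu> powr (1 - p/2) * norm (cond_proj n S (\<lambda>\<eta>. (norm (h \<eta>))\<^sup>2) \<epsilon>) powr (p/2))"
      proof (rule average_mono)
        fix \<epsilon> assume \<epsilon>: "\<epsilon> \<in> cube n"
        let ?q = "cond_proj n S (\<lambda>\<eta>. (norm (h \<eta>))\<^sup>2) \<epsilon>"
        have q: "0 \<le> ?q" by (simp add: cond_proj_eq average_nonneg)
        have "a \<epsilon> powr (p - 2) * (\<Sum>j\<in>J. (d j \<epsilon>)\<^sup>2) \<le> a \<epsilon> powr (p - 2) * ?q"
          unfolding d_def J_def by (intro mult_left_mono Bessel_sign_coeff \<epsilon>) simp
        also have "\<dots> \<le> \<mu> * a \<epsilon> powr p + \<mu> powr (1 - p/2) * ?q powr (p/2)"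
          using p \<mu> q by (intro crude_Young) (auto simp: a_def)
        finally show "a \<epsilon> powr (p - 2) * (\<Sum>j\<in>J. (d j \<epsilon>)\<^sup>2)
            \<le> \<mu> * a \<epsilon> powr p + \<mu> powr (1 - p/2) * norm ?q powr (p/2)" using q by simp
      qed
      also have "\<dots> = \<mu> * x S + \<mu> powr (1 - p/2) *
          average (cube n) (\<lambda>\<epsilon>. norm (cond_proj n S (\<lambda>\<eta>. (norm (h \<eta>))\<^sup>2) \<epsilon>) powr (p/2))"
        by (simp only: average_add average_cmult x_def a_def)
      also have "\<dots> \<le> \<mu> * x S + \<mu> powr (1 - p/2) *
          average (cube n) (\<lambda>\<epsilon>. norm ((norm (h \<epsilon>))\<^sup>2) powr (p/2))"
        using p by (intro add_left_mono mult_left_mono cond_proj_contraction) auto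
      also have "average (cube n) (\<lambda>\<epsilon>. norm ((norm (h \<epsilon>))\<^sup>2) powr (p/2)) = H"
      proof -
        have "norm ((norm y)\<^sup>2) powr (p/2) = norm y powr p" for y :: 'b
          using powr_powr[of "norm y" 2 "p/2"] by simp
        then show ?thesis by (simp add: H_def)
      qed
      finally show "average (cube n) (\<lambda>\<epsilon>. a \<epsilon> powr (p - 2) * (\<Sum>j\<in>J. (d j \<epsilon>)\<^sup>2))
          \<le> \<mu> * x S + \<mu> powr (1 - p/2) * H" .
      have "(\<Sum>j\<in>J. average (cube n) (\<lambda>\<epsilon>. d j \<epsilon> powr p))
          \<le> (\<Sum>j\<in>J. average (cube n) (\<lambda>\<epsilon>. norm (discrete_deriv j h \<epsilon>) powr p))"
      proof (rule sum_mono)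
        fix j assume j: "j \<in> J"
        have "average (cube n) (\<lambda>\<epsilon>. d j \<epsilon> powr p)
            = average (cube n) (\<lambda>\<epsilon>. norm (cond_proj n (insert j S) (discrete_deriv j h) \<epsilon>) powr p)"
          using j by (intro average_cong) (simp add: d_def J_def sign_coeff_eq_cond_proj_deriv)
        also have "\<dots> \<le> average (cube n) (\<lambda>\<epsilon>. norm (discrete_deriv j h \<epsilon>) powr p)"
          using p by (intro cond_proj_contraction) simp
        finally show "average (cube n) (\<lambda>\<epsilon>. d j \<epsilon> powr p) \<le> \<dots>" .
      qed
      also have "\<dots> \<le> D"
        unfolding D_def by (rule sum_mono2) (auto simp: J_def intro!: average_nonneg)
      finally show "(\<Sum>j\<in>J. average (cube n) (\<lambda>\<epsilon>. d j \<epsilon> powr p)) \<le> D" .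
    qed (use B Y in auto)
    finally have *: "(\<Sum>j\<in>J. x (insert j S))
        \<le> real (n - i) * x S + (B * (\<mu> * x S + \<mu> powr (1 - p/2) * H) + Y * D)"
      by (simp add: cardJ add.assoc)
    have ni: "0 < real (n - i)" "1 / real (n - i) \<le> 2 / real n"
      using i by (auto simp: field_simps of_nat_diff)
    have "1 / real (n - i) * (\<Sum>j\<in>J. x (insert j S))
        \<le> 1 / real (n - i) * (real (n - i) * x S + (B * (\<mu> * x S + \<mu> powr (1 - p/2) * H) + Y * D))"
      using * by (rule mult_left_mono) simp
    also have "\<dots> = x S + 1 / real (n - i) * (B * (\<mu> * x S + \<mu> powr (1 - p/2) * H) + Y * D)"
      using ni by (simp add: distrib_left)
    also have "\<dots> \<le> x S + 2 / real n * (B * (\<mu> * x S + \<mu> powr (1 - p/2) * H) + Y * D)"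
      using ni B Y H D x \<mu> by (intro add_left_mono mult_right_mono) auto
    finally show ?thesis by (simp only: J_def)
  qed
  have ne: "k_subsets n i \<noteq> {}" using i by (intro k_subsets_nonempty) simp
  have "proj_moment n p h (Suc i)
      = average (k_subsets n i) (\<lambda>S. 1 / real (n - i) * (\<Sum>j\<in>{1..n}-S. x (insert j S)))"
    unfolding proj_moment_def x_def[symmetric] by (rule average_k_subsets_Suc[OF i(1)])
  also have "\<dots> \<le> average (k_subsets n i)
      (\<lambda>S. x S + 2 / real n * (B * (\<mu> * x S + \<mu> powr (1 - p/2) * H) + Y * D))"
    by (rule average_mono[OF single])
  also have "\<dots> = proj_moment n p h i
      + 2 / real n * (B * (\<mu> * proj_moment n p h i + \<mu> powr (1 - p/2) * H) + Y * D)"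
    unfolding proj_moment_def x_def[symmetric]
    by (simp only: average_add average_cmult average_const[OF finite_k_subsets ne])
  finally show ?thesis unfolding B_def Y_def H_def D_def .
qed

lemma affine_recursion_bound:
  fixes x :: "nat \<Rightarrow> real"
  assumes "0 \<le> \<alpha>" "0 \<le> \<beta>" "x 0 = 0" "\<And>i. i < k \<Longrightarrow> x (Suc i) \<le> (1 + \<alpha>) * x i + \<beta>"
  shows "x k \<le> real k * \<beta> * (1 + \<alpha>) ^ k"
  using assms(4)
proof (induction k)
  case 0
  then show ?case using assms by simp
next
  case (Suc k)
  have "x (Suc k) \<le> (1 + \<alpha>) * x k + \<beta>" using Suc.prems by simp
  also have "\<dots> \<le> (1 + \<alpha>) * (real k * \<beta> * (1 + \<alpha>) ^ k) + \<beta> * (1 + \<alpha>) ^ Suc k"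
  proof (rule add_mono)
    show "(1 + \<alpha>) * x k \<le> (1 + \<alpha>) * (real k * \<beta> * (1 + \<alpha>) ^ k)"
      using Suc assms(1) by (intro mult_left_mono) auto
    have "1 \<le> (1 + \<alpha>) ^ Suc k" using assms(1) by (intro one_le_power) simp
    then show "\<beta> \<le> \<beta> * (1 + \<alpha>) ^ Suc k" using assms(2) mult_left_mono by fastforce
  qed
  also have "\<dots> = real (Suc k) * \<beta> * (1 + \<alpha>) ^ Suc k" by (simp add: algebra_simps)
  finally show ?case .
qed

text \<open>The parameter \<open>\<mu>\<close> is chosen so that each of the \<open>k\<close> steps multiplies the moment by \<open>1 + p / k\<close>. The
total growth is then at most \<open>exp p\<close>, which costs only the factor \<open>exp 1\<close> after taking the
\<open>p\<close>-th root. The recursion starts from 0 because \<open>h\<close> has mean zero.\<close>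
lemma proj_moment_bound:
  fixes h :: "(nat \<Rightarrow> int) \<Rightarrow> 'b::real_inner"
  assumes p: "2 \<le> p" and k: "1 \<le> k" "2 * k \<le> n" and mean: "average (cube n) h = 0"
  shows "proj_moment n p h k \<le> exp p
    * (p * ((p powr (3/4) * sqrt (real k / real n)) powr p
          * average (cube n) (\<lambda>\<epsilon>. norm (h \<epsilon>) powr p))
      + 2 * (3 * p / ln p) powr p * (real k / real n
          * (\<Sum>j=1..n. average (cube n) (\<lambda>\<epsilon>. norm (discrete_deriv j h \<epsilon>) powr p))))"
proof -
  define t where "t = real k / real n"
  define Y where "Y = (3 * p / ln p) powr p"
  define H where "H = average (cube n) (\<lambda>\<epsilon>. norm (h \<epsilon>) powr p)"
  define D where "D = (\<Sum>j=1..n. average (cube n) (\<lambda>\<epsilon>. norm (discrete_deriv j h \<epsilon>) powr p))"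
  \<comment> \<open>Solves \<open>p powr (5/2) * \<mu> / n = p / k\<close>.\<close>
  define \<mu> where "\<mu> = 1 / (p powr (3/2) * t)"
  define \<alpha> where "\<alpha> = p / real k"
  define \<beta> where "\<beta> = (p powr (5/2) * \<mu> powr (1 - p/2) * H + 2 * Y * D) / real n"
  have H: "0 \<le> H" and D: "0 \<le> D" and Y: "0 \<le> Y"
    by (auto simp: H_def D_def Y_def intro!: average_nonneg sum_nonneg)
  have n: "0 < real n" "0 < real k" and t: "0 < t" using k by (auto simp: t_def)
  have \<mu>: "0 < \<mu>" using p t by (simp add: \<mu>_def)
  have p\<mu>: "p powr (5/2) * \<mu> = p / t"
    using p t powr_add[of p "3/2" 1] by (simp add: \<mu>_def field_simps)
  have \<alpha>: "0 \<le> \<alpha>" and \<beta>: "0 \<le> \<beta>" using p H D Y by (simp_all add: \<alpha>_def \<beta>_def)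
  have "proj_moment n p h k \<le> real k * \<beta> * (1 + \<alpha>) ^ k"
  proof (rule affine_recursion_bound[OF \<alpha> \<beta>])
    have "cond_proj n {} h \<epsilon> = 0" for \<epsilon>
      using mean by (simp add: cond_proj_def)
    then show "proj_moment n p h 0 = 0"
      by (simp add: proj_moment_def average_def)
    fix i assume i: "i < k"
    let ?x = "proj_moment n p h i"
    have "proj_moment n p h (Suc i) \<le> ?x + 2 / real n
        * (p powr (5/2) / 2 * (\<mu> * ?x + \<mu> powr (1 - p/2) * H) + Y * D)"
      unfolding H_def Y_def D_def using i k by (intro proj_moment_step p \<mu>) auto
    also have "\<dots> = ?x + (p powr (5/2) * \<mu>) / real n * ?x + \<beta>"
      by (simp add: \<beta>_def distrib_left add_divide_distrib)
    also have "(p powr (5/2) * \<mu>) / real n = \<alpha>"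
      unfolding p\<mu> using n by (simp add: t_def \<alpha>_def)
    finally show "proj_moment n p h (Suc i) \<le> (1 + \<alpha>) * ?x + \<beta>"
      by (simp add: algebra_simps)
  qed
  also have "\<dots> \<le> real k * \<beta> * exp p"
  proof -
    have "(1 + \<alpha>) ^ k \<le> exp \<alpha> ^ k" using \<alpha> by (intro power_mono) auto
    also have "\<dots> = exp p" using n by (simp add: \<alpha>_def flip: exp_of_nat_mult)
    finally show ?thesis using \<beta> by (intro mult_left_mono) auto
  qed
  also have "real k * \<beta> = p * ((p powr (3/4) * sqrt t) powr p * H) + 2 * Y * (t * D)"
  proof -
    have "\<mu> powr (1 - p/2) = \<mu> * (p powr (3/2) * t) powr (p/2)"
      using \<mu> p t by (simp add: powr_diff \<mu>_def powr_divide)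
    also have "(p powr (3/2) * t) powr (p/2) = (p powr (3/4) * sqrt t) powr p"
    proof -
      have "(p powr (3/4) * sqrt t) powr p = ((p powr (3/4) * sqrt t)\<^sup>2) powr (p/2)"
        using p t powr_powr[of "p powr (3/4) * sqrt t" 2 "p/2"] by simp
      also have "(p powr (3/4) * sqrt t)\<^sup>2 = p powr (3/2) * t"
        using p t powr_add[of p "3/4" "3/4"] by (simp add: power_mult_distrib power2_eq_square)
      finally show ?thesis ..
    qed
    finally have "real k * \<beta> = t * ((p powr (5/2) * \<mu>) * ((p powr (3/4) * sqrt t) powr p * H) + 2 * Y * D)"
      by (simp add: \<beta>_def t_def algebra_simps add_divide_distrib)
    then show ?thesis unfolding p\<mu> using t by (simp add: algebra_simps)
  qed
  finally show ?thesis unfolding t_def H_def Y_def D_def by (simp only: mult.commute)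
qed

section \<open>The estimate for scalar functions\<close>

lemma powr_add_superadditive:
  fixes x y :: real
  assumes "1 \<le> p" "0 \<le> x" "0 \<le> y"
  shows "x powr p + y powr p \<le> (x + y) powr p"
proof -
  have split: "z powr p = z * z powr (p - 1)" if "0 \<le> z" for z :: real
    using that powr_add[of z 1 "p - 1"] by (cases "z = 0") auto
  have "x powr p + y powr p \<le> x * (x + y) powr (p - 1) + y * (x + y) powr (p - 1)"
    unfolding split[OF assms(2)] split[OF assms(3)] using assms
    by (intro add_mono mult_left_mono powr_mono2) auto
  also have "\<dots> = (x + y) powr p"
    using assms split[of "x + y"] by (simp add: distrib_right)
  finally show ?thesis .
qed

lemma powr_inverse_le_iff:
  fixes x y :: real
  assumes "0 < p" "0 \<le> x" "0 \<le> y"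
  shows "x powr (1/p) \<le> y \<longleftrightarrow> x \<le> y powr p"
proof
  assume "x powr (1/p) \<le> y"
  then have "(x powr (1/p)) powr p \<le> y powr p" using assms by (intro powr_mono2) auto
  then show "x \<le> y powr p" using assms by (simp add: powr_powr)
next
  assume "x \<le> y powr p"
  then have "x powr (1/p) \<le> (y powr p) powr (1/p)" using assms by (intro powr_mono2) auto
  then show "x powr (1/p) \<le> y" using assms by (simp add: powr_powr)
qed

lemma cube_norm_powr:
  assumes "0 < p"
  shows "cube_norm n p f powr p = average (cube n) (\<lambda>\<epsilon>. norm (f \<epsilon>) powr p)"
  using assms average_nonneg[of "cube n" "\<lambda>\<epsilon>. norm (f \<epsilon>) powr p"]
  by (simp add: cube_norm_def powr_powr)

lemma cube_norm_nonneg: "0 \<le> cube_norm n p f"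
  by (simp add: cube_norm_def)

lemma ln_le_powr_quarter: "ln p \<le> 4 * p powr (1/4)" if "0 < p" for p :: real
  using ln_le_minus_one[of "p powr (1/4)"] that by (simp add: ln_powr)

text \<open>For \<open>2 * k \<le> n\<close> the \<open>p\<close>-th root of the moment bound is taken; here \<open>p powr (3/4) \<le> 4 * (p / ln p)\<close>,
and the factors \<open>p\<close> and 2 of the moment bound have \<open>p\<close>-th roots at most 3 and 2. For larger \<open>k\<close> the
number \<open>sqrt (k / n)\<close> is bounded below, and contractivity of the projections suffices.\<close>
lemma proj_moment_root_bound:
  fixes h :: "(nat \<Rightarrow> int) \<Rightarrow> 'b::real_inner"
  assumes p: "2 \<le> p" and k: "k \<in> {1..n}" and mean: "average (cube n) h = 0"
  shows "proj_moment n p h k powr (1/p)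
    \<le> 36 * (p / ln p) * (real k / real n
          * (\<Sum>j=1..n. cube_norm n p (discrete_deriv j h) powr p)) powr (1/p)
      + 36 * (p / ln p) * sqrt (real k / real n) * cube_norm n p h"
proof -
  define t where "t = real k / real n"
  define H where "H = cube_norm n p h"
  define D where "D = (\<Sum>j=1..n. cube_norm n p (discrete_deriv j h) powr p)"
  have H: "0 \<le> H" and D: "0 \<le> D" and t: "0 < t"
    using k by (auto simp: H_def D_def t_def cube_norm_nonneg intro!: sum_nonneg)
  have lnp: "0 < ln p" "ln p \<le> p" using p ln_le_minus_one[of p] by auto
  have Hp: "average (cube n) (\<lambda>\<epsilon>. norm (h \<epsilon>) powr p) = H powr p"
    using p by (simp add: H_def cube_norm_powr)
  have X: "0 \<le> proj_moment n p h k"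
    unfolding proj_moment_def by (intro average_nonneg) auto
  show ?thesis
  proof (cases "2 * k \<le> n")
    case True
    \<comment> \<open>The factor 36 is \<open>3 * 12\<close>: 3 bounds \<open>exp 1\<close>, and \<open>12 = 3 * 4\<close> combines \<open>p \<le> 3 powr p\<close> with \<open>ln p \<le> 4 * p powr (1/4)\<close>.\<close>
    define u where "u = 12 * (p / ln p) * sqrt t * H"
    define v where "v = 6 * (p / ln p) * (t * D) powr (1/p)"
    have u: "0 \<le> u" and v: "0 \<le> v" using lnp H t p by (simp_all add: u_def v_def)
    have Dp: "(\<Sum>j=1..n. average (cube n) (\<lambda>\<epsilon>. norm (discrete_deriv j h \<epsilon>) powr p)) = D"
      using p by (simp add: D_def cube_norm_powr)
    have "proj_moment n p h k \<le> exp p * (p * ((p powr (3/4) * sqrt t) powr p * H powr p)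
        + 2 * (3 * p / ln p) powr p * (t * D))"
      using proj_moment_bound[OF p, of k n h] k True mean unfolding Hp Dp t_def by auto
    also have "\<dots> \<le> exp p * (u powr p + v powr p)"
    proof (intro mult_left_mono add_mono)
      have "p \<le> exp p" using exp_ge_add_one_self[of p] by linarith
      also have "\<dots> = exp 1 powr p" by (simp add: exp_powr_real)
      also have "\<dots> \<le> 3 powr p" using p exp_le by (intro powr_mono2) auto
      finally have le3: "p \<le> 3 powr p" .
      have "p * ((p powr (3/4) * sqrt t) powr p * H powr p)
          \<le> 3 powr p * ((p powr (3/4) * sqrt t) powr p * H powr p)"
        using le3 by (intro mult_right_mono) auto
      also have "\<dots> = (3 * (p powr (3/4) * sqrt t) * H) powr p"
        by (simp only: powr_mult mult.assoc)
      also have "\<dots> \<le> u powr p"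
      proof (rule powr_mono2)
        have "p powr (3/4) * ln p \<le> p powr (3/4) * (4 * p powr (1/4))"
          using p ln_le_powr_quarter[of p] by (intro mult_left_mono) auto
        also have "\<dots> = 4 * p" using p powr_add[of p "3/4" "1/4"] by simp
        finally have "3 * p powr (3/4) \<le> 12 * (p / ln p)" using lnp by (simp add: field_simps)
        then have "3 * p powr (3/4) * (sqrt t * H) \<le> 12 * (p / ln p) * (sqrt t * H)"
          using H t by (intro mult_right_mono) auto
        then show "3 * (p powr (3/4) * sqrt t) * H \<le> u" by (simp add: u_def mult_ac)
      qed (use p H t in auto)
      finally show "p * ((p powr (3/4) * sqrt t) powr p * H powr p) \<le> u powr p" .
      have "2 * (3 * p / ln p) powr p * (t * D) \<le> 2 powr p * (3 * p / ln p) powr p * (t * D)"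
        using p D t powr_mono[of 1 p 2] by (intro mult_right_mono) auto
      also have "\<dots> = 2 powr p * (3 * p / ln p) powr p * ((t * D) powr (1/p)) powr p"
        using p D t by (simp add: powr_powr)
      also have "\<dots> = (2 * (3 * p / ln p) * (t * D) powr (1/p)) powr p"
        by (simp only: powr_mult)
      also have "2 * (3 * p / ln p) * (t * D) powr (1/p) = v" by (simp add: v_def)
      finally show "2 * (3 * p / ln p) powr p * (t * D) \<le> v powr p" .
    qed simp
    also have "\<dots> \<le> exp p * (u + v) powr p"
      using p u v by (intro mult_left_mono powr_add_superadditive) auto
    also have "\<dots> = (exp 1 * (u + v)) powr p"
      by (simp add: powr_mult exp_powr_real)
    finally have "proj_moment n p h k powr (1/p) \<le> exp 1 * (u + v)"
      using p X u v by (subst powr_inverse_le_iff) auto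
    also have "\<dots> \<le> 3 * (u + v)"
      using exp_le u v by (intro mult_right_mono) auto
    also have "\<dots> \<le> 36 * (p / ln p) * (t * D) powr (1/p) + 36 * (p / ln p) * sqrt t * H"
    proof -
      have "18 * (p / ln p) * (t * D) powr (1/p) \<le> 36 * (p / ln p) * (t * D) powr (1/p)"
        using p lnp by (intro mult_right_mono) auto
      moreover have "3 * u = 36 * (p / ln p) * sqrt t * H" "3 * v = 18 * (p / ln p) * (t * D) powr (1/p)"
        by (simp_all add: u_def v_def)
      ultimately show ?thesis unfolding distrib_left by linarith
    qed
    finally show ?thesis unfolding t_def D_def H_def .
  next
    case False
    have ne: "k_subsets n k \<noteq> {}" using k by (intro k_subsets_nonempty) simp
    have "proj_moment n p h k \<le> average (k_subsets n k) (\<lambda>S. H powr p)"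
      unfolding proj_moment_def Hp[symmetric] using p
      by (intro average_mono cond_proj_contraction) simp
    then have "proj_moment n p h k \<le> H powr p" using ne by (simp add: average_const)
    then have "proj_moment n p h k powr (1/p) \<le> H"
      using p X H by (subst powr_inverse_le_iff) auto
    also have "\<dots> \<le> 36 * (p / ln p) * sqrt t * H"
    proof -
      have "1 / 4 \<le> t" using False k by (simp add: t_def field_simps)
      then have "sqrt (1 / 4) \<le> sqrt t" by (rule real_sqrt_le_mono)
      then have "1 / 2 \<le> sqrt t" by (simp add: real_sqrt_divide)
      moreover have "1 \<le> p / ln p" using lnp by simp
      ultimately have "1 * (1/2) \<le> (p / ln p) * sqrt t" by (intro mult_mono) auto
      then have "1 * H \<le> (36 * (p / ln p) * sqrt t) * H" using H by (intro mult_right_mono) auto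
      then show ?thesis by simp
    qed
    also have "\<dots> \<le> 36 * (p / ln p) * (t * D) powr (1/p) + 36 * (p / ln p) * sqrt t * H"
      using p lnp by simp
    finally show ?thesis unfolding t_def D_def H_def .
  qed
qed

text \<open>Only the inner product matters, so the real and the complex case are the same.\<close>
lemma scalar_bound_real_inner: "scalar_bound 36 TYPE('b::real_inner)"
  unfolding scalar_bound_def
proof (intro allI impI, elim conjE)
  fix p :: real and n k :: nat and h :: "(nat \<Rightarrow> int) \<Rightarrow> 'b"
  assume p: "2 \<le> p" and k: "k \<in> {1..n}" and mean: "average (cube n) h = 0"
  let ?t = "real k / real n" and ?H = "cube_norm n p h"
  have moment: "average (k_subsets n k) (\<lambda>S. cube_norm n p (cond_proj n S h) powr p) = proj_moment n p h k"
    using p by (simp add: proj_moment_def cube_norm_powr)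
  have "36 * (p / ln p) * sqrt ?t * ?H \<le> 36 * pi / 2 * (p / ln p) * sqrt ?t * ?H"
    using p pi_ge_two cube_norm_nonneg[of n p h] by (intro mult_right_mono) auto
  moreover have "0 \<le> ?t * ?H" using cube_norm_nonneg[of n p h] by simp
  ultimately show "scalar_estimate 36 p n k h"
    unfolding scalar_estimate_def Let_def moment
    using proj_moment_root_bound[OF p k mean] by linarith
qed

section \<open>Transfer to functions with values in an Lp space\<close>

text \<open>The triangle inequality in \<open>L\<^sub>p\<close>, stated for \<open>p\<close>-th powers: the functions \<open>f\<close>, \<open>g\<close>, \<open>h\<close> are
the \<open>p\<close>-th powers of the functions that are compared. After normalization by \<open>G\<close> and \<open>H\<close> it is the
convexity of \<open>x \<mapsto> x powr p\<close>; adding a small \<open>e > 0\<close> to the coefficients and to the norms makes the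
normalization possible when some of them vanish.\<close>
lemma Minkowski_integral:
  fixes f g h :: "'a \<Rightarrow> real"
  assumes p: "1 \<le> p"
    and int: "integrable M f" "integrable M g" "integrable M h"
    and nn: "\<And>x. 0 \<le> f x" "\<And>x. 0 \<le> g x" "\<And>x. 0 \<le> h x"
    and ab: "0 \<le> a" "0 \<le> b"
    and le: "AE x in M. f x powr (1/p) \<le> a * g x powr (1/p) + b * h x powr (1/p)"
  shows "(\<integral>x. f x \<partial>M) powr (1/p) \<le> a * (\<integral>x. g x \<partial>M) powr (1/p) + b * (\<integral>x. h x \<partial>M) powr (1/p)"
proof -
  let ?G = "(\<integral>x. g x \<partial>M) powr (1/p)" and ?H = "(\<integral>x. h x \<partial>M) powr (1/p)"
  have I: "0 \<le> (\<integral>x. f x \<partial>M)" "0 \<le> (\<integral>x. g x \<partial>M)" "0 \<le> (\<integral>x. h x \<partial>M)"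
    using nn by simp_all
  have bound: "(\<integral>x. f x \<partial>M) powr (1/p) \<le> (a + e) * (?G + e) + (b + e) * (?H + e)" if e: "0 < e" for e
  proof -
    define G where "G = ?G + e"
    define H where "H = ?H + e"
    define s where "s = (a + e) * G + (b + e) * H"
    define w where "w = (b + e) * H / s"
    have G: "0 < G" and H: "0 < H" using e by (auto simp: G_def H_def intro: add_nonneg_pos)
    have ae: "0 < a + e" "0 < b + e" using e ab by auto
    have s: "0 < s" using G H ae by (simp add: s_def add_pos_pos)
    have pos: "0 < (a + e) * G" "0 < (b + e) * H" using G H ae by simp_all
    have w1: "1 - w = (a + e) * G / s" using s by (simp add: w_def field_simps) (simp add: s_def algebra_simps)
    have "0 \<le> w" "0 \<le> 1 - w" unfolding w1 using pos s by (simp_all add: w_def)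
    then have w: "0 \<le> w" "w \<le> 1" by simp_all
    have "AE x in M. f x \<le> s powr p * ((1 - w) * (g x / G powr p) + w * (h x / H powr p))"
      using le
    proof eventually_elim
      case (elim x)
      let ?g = "g x powr (1/p)" and ?h = "h x powr (1/p)"
      have "f x powr (1/p) \<le> (a + e) * ?g + (b + e) * ?h"
        using elim e by (intro order_trans[OF elim] add_mono mult_right_mono) auto
      also have "\<dots> = s * ((1 - w) * (?g / G) + w * (?h / H))"
        using s G H by (simp add: w1) (simp add: w_def field_simps)
      finally have "f x \<le> (s * ((1 - w) * (?g / G) + w * (?h / H))) powr p"
        using p nn s G H w by (subst powr_inverse_le_iff[symmetric]) auto
      also have "\<dots> = s powr p * ((1 - w) *\<^sub>R (?g / G) + w *\<^sub>R (?h / H)) powr p"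
        by (simp add: powr_mult)
      also have "\<dots> \<le> s powr p * ((1 - w) * (?g / G) powr p + w * (?h / H) powr p)"
        using w G H by (intro mult_left_mono convex_onD[OF convex_on_powr_nonneg[OF p]]) auto
      also have "\<dots> = s powr p * ((1 - w) * (g x / G powr p) + w * (h x / H powr p))"
        using p nn by (simp add: powr_divide powr_powr)
      finally show ?case .
    qed
    then have "(\<integral>x. f x \<partial>M) \<le> (\<integral>x. s powr p * ((1 - w) * (g x / G powr p) + w * (h x / H powr p)) \<partial>M)"
      using int by (intro integral_mono_AE) auto
    also have "\<dots> = s powr p * ((1 - w) * ((\<integral>x. g x \<partial>M) / G powr p) + w * ((\<integral>x. h x \<partial>M) / H powr p))"
      using int by simp
    also have "\<dots> \<le> s powr p * ((1 - w) * 1 + w * 1)"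
    proof -
      have "(\<integral>x. g x \<partial>M) \<le> G powr p" "(\<integral>x. h x \<partial>M) \<le> H powr p"
        using p I G H e powr_inverse_le_iff[of p "\<integral>x. g x \<partial>M" G]
          powr_inverse_le_iff[of p "\<integral>x. h x \<partial>M" H] by (simp_all add: G_def H_def)
      then show ?thesis using w G H
        by (intro mult_left_mono add_mono) (auto simp: divide_le_eq)
    qed
    finally have "(\<integral>x. f x \<partial>M) \<le> s powr p" by simp
    then show ?thesis
      using p s I by (subst powr_inverse_le_iff) (auto simp: s_def G_def H_def)
  qed
  have "((\<lambda>e. (a + e) * (?G + e) + (b + e) * (?H + e)) \<longlongrightarrow> (a + 0) * (?G + 0) + (b + 0) * (?H + 0)) (at_right 0)"
    by (intro tendsto_intros)
  moreover have "\<forall>\<^sub>F e in at_right 0. (\<integral>x. f x \<partial>M) powr (1/p) \<le> (a + e) * (?G + e) + (b + e) * (?H + e)"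
    by (rule eventually_mono[OF eventually_at_right_less bound])
  ultimately have "(\<integral>x. f x \<partial>M) powr (1/p) \<le> (a + 0) * (?G + 0) + (b + 0) * (?H + 0)"
    by (rule tendsto_lowerbound) simp
  then show ?thesis by simp
qed

lemma Lp_norm_powr:
  assumes "0 < p"
  shows "Lp_norm p M f powr p = (\<integral>x. norm (f x) powr p \<partial>M)"
  using assms by (simp add: Lp_norm_def powr_powr)

lemma in_Lp_add:
  assumes "0 \<le> p" "in_Lp p M f" "in_Lp p M g"
  shows "in_Lp p M (\<lambda>x. f x + g x)"
proof -
  have [measurable]: "f \<in> borel_measurable M" "g \<in> borel_measurable M"
    using assms by (auto simp: in_Lp_def)
  have "norm (f x + g x) powr p \<le> 2 powr p * (norm (f x) powr p + norm (g x) powr p)" for x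
  proof -
    have "norm (f x + g x) \<le> 2 * max (norm (f x)) (norm (g x))"
      using norm_triangle_ineq[of "f x" "g x"] by linarith
    then have "norm (f x + g x) powr p \<le> (2 * max (norm (f x)) (norm (g x))) powr p"
      using assms by (intro powr_mono2) auto
    also have "\<dots> = 2 powr p * max (norm (f x)) (norm (g x)) powr p" by (rule powr_mult)
    also have "\<dots> \<le> 2 powr p * (norm (f x) powr p + norm (g x) powr p)"
      by (intro mult_left_mono) (simp_all add: max_def)
    finally show ?thesis .
  qed
  then have "AE x in M. norm (norm (f x + g x) powr p) \<le> norm (2 powr p * (norm (f x) powr p + norm (g x) powr p))"
    by (simp add: add_nonneg_nonneg abs_mult)
  moreover have "integrable M (\<lambda>x. 2 powr p * (norm (f x) powr p + norm (g x) powr p))"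
    using assms by (simp add: in_Lp_def)
  ultimately have "integrable M (\<lambda>x. norm (f x + g x) powr p)"
    by (rule Bochner_Integration.integrable_bound[rotated 2]) measurable
  then show ?thesis by (simp add: in_Lp_def)
qed

lemma in_Lp_scaleR: "in_Lp p M f \<Longrightarrow> in_Lp p M (\<lambda>x. c *\<^sub>R f x)"
  by (auto simp: in_Lp_def powr_mult)

lemma in_Lp_sum:
  assumes "0 \<le> p" "finite A" "\<And>i. i \<in> A \<Longrightarrow> in_Lp p M (f i)"
  shows "in_Lp p M (\<lambda>x. \<Sum>i\<in>A. f i x)"
  using assms(2,3)
proof (induction A rule: finite_induct)
  case empty
  then show ?case by (simp add: in_Lp_def)
next
  case (insert i A)
  then show ?case using assms(1) by (simp add: in_Lp_add)
qed

text \<open>Since the cube is finite, the \<open>p\<close>-th power of the Bochner norm is the integral over \<open>M\<close> of the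
\<open>p\<close>-th powers of the scalar norms of the sections \<open>\<lambda>\<epsilon>. h \<epsilon> x\<close>.\<close>
lemma bochner_norm_powr:
  assumes p: "0 < p" and h: "\<And>\<epsilon>. \<epsilon> \<in> cube n \<Longrightarrow> in_Lp p M (h \<epsilon>)"
  shows "bochner_norm n p M h powr p = (\<integral>x. cube_norm n p (\<lambda>\<epsilon>. h \<epsilon> x) powr p \<partial>M)" (is ?eq)
    and "integrable M (\<lambda>x. cube_norm n p (\<lambda>\<epsilon>. h \<epsilon> x) powr p)" (is ?int)
proof -
  have int: "integrable M (\<lambda>x. norm (h \<epsilon> x) powr p)" if "\<epsilon> \<in> cube n" for \<epsilon>
    using h[OF that] by (simp add: in_Lp_def)
  show ?int using int by (simp add: cube_norm_powr[OF p] average_def)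
  have "bochner_norm n p M h powr p = average (cube n) (\<lambda>\<epsilon>. Lp_norm p M (h \<epsilon>) powr p)"
    using p average_nonneg[of "cube n" "\<lambda>\<epsilon>. Lp_norm p M (h \<epsilon>) powr p"]
    by (simp add: bochner_norm_def powr_powr)
  then show ?eq using int by (simp add: cube_norm_powr[OF p] average_def Lp_norm_powr[OF p])
qed

text \<open>The scalar estimate holds for the section \<open>\<lambda>\<epsilon>. h \<epsilon> x\<close> at almost every \<open>x\<close>. Its first and last term
are multiples of the same norm, so it has the form \<open>F powr (1/p) \<le> a * G powr (1/p) + b * D powr (1/p)\<close> with nonnegative
\<open>a\<close> and \<open>b\<close>, and Minkowski integrates it without changing the constant.\<close>
lemma Lp_bound_if_scalar_bound:
  assumes C: "0 < C" and scalar: "scalar_bound C TYPE('b::{banach, second_countable_topology})"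
  shows "Lp_bound C (M :: 'a measure) TYPE('b)"
  unfolding Lp_bound_def
proof (intro allI impI, elim conjE)
  fix p :: real and n k :: nat and h :: "(nat \<Rightarrow> int) \<Rightarrow> 'a \<Rightarrow> 'b"
  assume p: "2 \<le> p" and k: "k \<in> {1..n}" and h: "\<forall>\<epsilon>\<in>cube n. in_Lp p M (h \<epsilon>)"
    and mean: "AE x in M. average (cube n) (\<lambda>\<epsilon>. h \<epsilon> x) = 0"
  define t where "t = real k / real n"
  define a where "a = t + C * pi / 2 * (p / ln p) * sqrt t"
  define b where "b = C * (p / ln p)"
  define F where "F x = average (k_subsets n k) (\<lambda>S. cube_norm n p (cond_proj n S (\<lambda>\<epsilon>. h \<epsilon> x)) powr p)" for x
  define G where "G x = cube_norm n p (\<lambda>\<epsilon>. h \<epsilon> x) powr p" for x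
  define D where "D x = t * (\<Sum>j=1..n. cube_norm n p (discrete_deriv j (\<lambda>\<epsilon>. h \<epsilon> x)) powr p)" for x
  have p0: "0 < p" using p by simp
  have t: "0 \<le> t" by (simp add: t_def)
  have ab: "0 \<le> a" "0 \<le> b" using p C t by (auto simp: a_def b_def)
  have cond: "in_Lp p M (cond_proj_Lp n S h \<epsilon>)" for S \<epsilon>
  proof -
    have "in_Lp p M (\<lambda>x. (1 / real (card (cube_fiber n S \<epsilon>))) *\<^sub>R (\<Sum>\<eta>\<in>cube_fiber n S \<epsilon>. h \<eta> x))"
      using h p by (intro in_Lp_scaleR in_Lp_sum) (auto dest: cube_fiber_subset)
    then show ?thesis by (simp add: cond_proj_Lp_def[abs_def] cond_proj_eq average_def)
  qed
  have deriv: "in_Lp p M (discrete_deriv_Lp j h \<epsilon>)" if "j \<in> {1..n}" "\<epsilon> \<in> cube n" for j \<epsilon>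
  proof -
    have "in_Lp p M (\<lambda>x. (1/2) *\<^sub>R (h \<epsilon> x + (-1) *\<^sub>R h (flip_coord j \<epsilon>) x))"
      using p that by (intro in_Lp_scaleR in_Lp_add h[rule_format] flip_coord_in_cube) auto
    then show ?thesis by (simp add: discrete_deriv_Lp_def[abs_def] discrete_deriv_def)
  qed
  have F: "integrable M F" "(\<integral>x. F x \<partial>M) = average (k_subsets n k) (\<lambda>S. bochner_norm n p M (cond_proj_Lp n S h) powr p)"
  proof -
    have eq: "(\<lambda>\<epsilon>. cond_proj_Lp n S h \<epsilon> x) = cond_proj n S (\<lambda>\<epsilon>. h \<epsilon> x)" for S x
      by (simp add: cond_proj_Lp_def[abs_def])
    note * = bochner_norm_powr[of p n M "cond_proj_Lp n S h" for S, OF p0 cond, unfolded eq]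
    show "integrable M F" using *(2) by (simp add: F_def[abs_def] average_def)
    show "(\<integral>x. F x \<partial>M) = average (k_subsets n k) (\<lambda>S. bochner_norm n p M (cond_proj_Lp n S h) powr p)"
      using *(2) by (simp add: F_def[abs_def] average_def *(1))
  qed
  have G: "integrable M G" "(\<integral>x. G x \<partial>M) = bochner_norm n p M h powr p"
    using bochner_norm_powr[OF p0, of n M h] h by (auto simp: G_def[abs_def])
  have D: "integrable M D" "(\<integral>x. D x \<partial>M) = t * (\<Sum>j=1..n. bochner_norm n p M (discrete_deriv_Lp j h) powr p)"
  proof -
    have eq: "(\<lambda>\<epsilon>. discrete_deriv_Lp j h \<epsilon> x) = discrete_deriv j (\<lambda>\<epsilon>. h \<epsilon> x)" for j x
      by (simp add: discrete_deriv_Lp_def[abs_def])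
    note * = bochner_norm_powr[of p n M "discrete_deriv_Lp j h" for j, OF p0 deriv, unfolded eq]
    show "integrable M D" using *(2) by (auto simp: D_def[abs_def])
    show "(\<integral>x. D x \<partial>M) = t * (\<Sum>j=1..n. bochner_norm n p M (discrete_deriv_Lp j h) powr p)"
      using *(2) by (simp add: D_def[abs_def] *(1))
  qed
  have nn: "0 \<le> F x" "0 \<le> G x" "0 \<le> D x" for x
    using t by (auto simp: F_def G_def D_def intro!: average_nonneg mult_nonneg_nonneg sum_nonneg)
  have pointwise: "AE x in M. F x powr (1/p) \<le> a * G x powr (1/p) + b * D x powr (1/p)"
    using mean
  proof eventually_elim
    case (elim x)
    then have "scalar_estimate C p n k (\<lambda>\<epsilon>. h \<epsilon> x)"
      using scalar p k by (auto simp: scalar_bound_def)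
    moreover have "G x powr (1/p) = cube_norm n p (\<lambda>\<epsilon>. h \<epsilon> x)"
      using p by (simp add: G_def powr_powr cube_norm_nonneg)
    ultimately show ?case
      unfolding scalar_estimate_def Let_def F_def D_def a_def b_def t_def[symmetric]
      by (simp add: distrib_right)
  qed
  have "(\<integral>x. F x \<partial>M) powr (1/p) \<le> a * (\<integral>x. G x \<partial>M) powr (1/p) + b * (\<integral>x. D x \<partial>M) powr (1/p)"
    using p by (intro Minkowski_integral[OF _ F(1) G(1) D(1) nn ab pointwise]) simp
  moreover have "0 \<le> bochner_norm n p M h" by (simp add: bochner_norm_def)
  then have "(bochner_norm n p M h powr p) powr (1/p) = bochner_norm n p M h"
    using p by (simp add: powr_powr)
  ultimately show "Lp_estimate C p n k M h"
    unfolding Lp_estimate_def Let_def F(2) G(2) D(2) a_def b_def t_def[symmetric]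
    by (simp add: distrib_right)
qed

theorem theorem1p2:
  shows "(\<exists>C. scalar_constant C) \<and>
    (\<forall>C. scalar_constant C \<longrightarrow>
      (\<forall>M :: 'a measure. Lp_bound C M TYPE(real) \<and> Lp_bound C M TYPE(complex)))"
proof
  have "scalar_constant 36"
    unfolding scalar_constant_def by (simp add: scalar_bound_real_inner)
  then show "\<exists>C. scalar_constant C" ..
qed (auto simp: scalar_constant_def intro: Lp_bound_if_scalar_bound)

end
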